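(* Let $\mathfrak g=\mathfrak{sl}_3$, $\theta$ the automorphism induced by the nontrivial diagram automorphism ($e_1\leftrightarrow e_2$, $f_1\leftrightarrow f_2$, $h_1\leftrightarrow h_2$), and $\mathcal L^{\mathrm{tw}}$ the associated twisted loop algebra of the second kind. For each $\phi \in (\mathcal{L}^{\mathrm{tw},0})^*$, the following are equivalent: (1) $\dim V(\phi) < \infty$. (2) There exist $\nu_1,\nu_{-1} \in \frac{1}{2}\mathbb{Z}_{\geq 0}$, $n \in \mathbb{Z}_{\geq 0}$, and $\alpha_1,\dots,\alpha_n \in \mathbb{C}^\times \setminus \{ \pm 1 \}$ such that for all $a\in\mathbb Z_{\ge0}$ $$\phi(w_{+,a,0}) = \nu_1 \cdot 2^a + \nu_{-1} \cdot (-2)^a + \sum_{i=1}^n (\alpha_i+\alpha_i^{-1})^a,$$ $$\phi(w_{-,a,1}) = \sum_{i=1}^n (\alpha_i+\alpha_i^{-1})^a (\alpha_i-\alpha_i^{-1}).$$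
   Context: Let $e_i,f_i,h_i$ ($i=1,2$) be Chevalley generators of $\mathfrak{sl}_3$ over $\mathbb C$, with triangular decomposition $\mathfrak g=\mathfrak n^-\oplus\mathfrak h\oplus\mathfrak n^+$. Let $\mathcal L=\mathbb C[t,t^{-1}]\otimes\mathfrak g$ be the loop algebra with $[P\otimes x,Q\otimes y]=PQ\otimes[x,y]$, extend $\theta$ by $\theta(t^m\otimes x)=t^{-m}\otimes\theta(x)$, and let $\mathcal L^{\mathrm{tw}}=\{\mathfrak x\in\mathcal L\mid\theta(\mathfrak x)=\mathfrak x\}$. Put $\mathcal L^{\mathrm{tw},+}=\mathcal L^{\mathrm{tw}}\cap(\mathbb C[t,t^{-1}]\otimes\mathfrak n^+)$ and $\mathcal L^{\mathrm{tw},0}=\mathcal L^{\mathrm{tw}}\cap(\mathbb C[t,t^{-1}]\otimes\mathfrak h)$. With $t_\pm=t\pm t^{-1}$ and $w_\pm=h_1\pm h_2$, set $w_{\pm,a,b}=t_+^at_-^b\otimes w_\pm$; the elements $w_{+,a,0},w_{-,a,1}$ ($a\ge0$) form a basis of $\mathcal L^{\mathrm{tw},0}$. For $\phi\in(\mathcal L^{\mathrm{tw},0})^*$ (linear dual), $V(\phi)$ denotes the unique simple quotient of the universal highest weight module of highest weight $\phi$, i.e. the unique simple $\mathcal L^{\mathrm{tw}}$-module generated by a nonzero vector $v_\phi$ with $\mathcal L^{\mathrm{tw},+}v_\phi=0$ and $wv_\phi=\phi(w)v_\phi$ for all $w\in\mathcal L^{\mathrm{tw},0}$. Convention: $z^0=1$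 for all $z\in\mathbb C$. *)

theory Defs
  imports "HOL-Analysis.Analysis" "HOL-Library.Poly_Mapping"
begin

text \<open>
  The ring of Laurent polynomials over the complex numbers is the monoid algebra of the additive
  monoid \<^typ>\<open>int\<close>: the product of \<^typ>\<open>int \<Rightarrow>\<^sub>0 complex\<close> is convolution and
  \<open>single m c\<close> stands for \<open>c t^m\<close>.
\<close>

type_synonym laurent = "int \<Rightarrow>\<^sub>0 complex"

definition laurent_const :: "complex \<Rightarrow> laurent" where
  "laurent_const c = Poly_Mapping.single 0 c"

definition t_pow :: "int \<Rightarrow> laurent" where
  "t_pow m = Poly_Mapping.single m 1"

definition t_plus :: laurent where
  "t_plus = t_pow 1 + t_pow (- 1)"

definition t_minus :: laurent where
  "t_minus = t_pow 1 - t_pow (- 1)"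

text \<open>The substitution of \<open>t^{-1}\<close> for \<open>t\<close>.\<close>

definition laurent_flip :: "laurent \<Rightarrow> laurent" where
  "laurent_flip P = Poly_Mapping.map_key uminus P"

text \<open>
  The Lie algebra \<open>sl_3\<close> and its triangular decomposition are defined over an arbitrary commutative
  ring \<open>R\<close>, because \<open>R \<otimes> sl_3(\<complex>)\<close> is identified with \<open>sl_3(R)\<close> for the ring \<open>R\<close> of Laurent
  polynomials; under this identification the commutator of matrices over \<open>R\<close> is the bracket
  \<open>[P \<otimes> x, Q \<otimes> y] = PQ \<otimes> [x, y]\<close> (see \<open>lie_bracket_loop_tensor\<close> and
  \<open>loop_algebra_eq_sum\<close> below).
\<close>

definition lie_bracket :: "'a::comm_ring_1^3^3 \<Rightarrow> 'a^3^3 \<Rightarrow> 'a^3^3" where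
  "lie_bracket x y = x ** y - y ** x"

definition mat_scale :: "'a::comm_ring_1 \<Rightarrow> 'a^3^3 \<Rightarrow> 'a^3^3" where
  "mat_scale c x = map_matrix (\<lambda>a. c * a) x"

definition sl3 :: "('a::comm_ring_1^3^3) set" where
  "sl3 = {x. trace x = 0}"

definition sl3_pos :: "('a::comm_ring_1^3^3) set" where
  "sl3_pos = {x. x$1$1 = 0 \<and> x$2$1 = 0 \<and> x$2$2 = 0 \<and> x$3$1 = 0 \<and> x$3$2 = 0 \<and> x$3$3 = 0}"

definition sl3_cartan :: "('a::comm_ring_1^3^3) set" where
  "sl3_cartan = {x \<in> sl3. \<forall>i j. i \<noteq> j \<longrightarrow> x$i$j = 0}"

definition matrix_unit :: "3 \<Rightarrow> 3 \<Rightarrow> 'a::comm_ring_1^3^3" where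
  "matrix_unit k l = (\<chi> i j. if i = k \<and> j = l then 1 else 0)"

definition chev_e1 :: "'a::comm_ring_1^3^3" where "chev_e1 = matrix_unit 1 2"
definition chev_e2 :: "'a::comm_ring_1^3^3" where "chev_e2 = matrix_unit 2 3"
definition chev_f1 :: "'a::comm_ring_1^3^3" where "chev_f1 = matrix_unit 2 1"
definition chev_f2 :: "'a::comm_ring_1^3^3" where "chev_f2 = matrix_unit 3 2"
definition chev_h1 :: "'a::comm_ring_1^3^3" where "chev_h1 = matrix_unit 1 1 - matrix_unit 2 2"
definition chev_h2 :: "'a::comm_ring_1^3^3" where "chev_h2 = matrix_unit 2 2 - matrix_unit 3 3"

text \<open>
  The automorphism induced by the nontrivial diagram automorphism, realised as
  \<open>x \<mapsto> - J x^T J^{-1}\<close>; here \<open>J\<close> is its own inverse. It is the unique Lie algebra automorphism of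
  \<open>sl_3\<close> exchanging the Chevalley generators (\<open>diagram_aut_unique\<close> below).
\<close>

definition diagram_form :: "'a::comm_ring_1^3^3" where
  "diagram_form = vector [vector [0, 0, 1], vector [0, -1, 0], vector [1, 0, 0]]"

definition diagram_aut :: "'a::comm_ring_1^3^3 \<Rightarrow> 'a^3^3" where
  "diagram_aut x = - (diagram_form ** transpose x ** diagram_form)"


subsection \<open>The twisted loop algebra\<close>

type_synonym loop = "laurent^3^3"

definition loop_tensor :: "laurent \<Rightarrow> complex^3^3 \<Rightarrow> loop" where
  "loop_tensor P x = map_matrix (\<lambda>c. P * laurent_const c) x"

abbreviation loop_algebra :: "loop set" where
  "loop_algebra \<equiv> sl3"

definition loop_scale :: "complex \<Rightarrow> loop \<Rightarrow> loop" where
  "loop_scale c X = mat_scale (laurent_const c) X"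

definition loop_aut :: "loop \<Rightarrow> loop" where
  "loop_aut X = diagram_aut (map_matrix laurent_flip X)"

definition Ltw :: "loop set" where
  "Ltw = {X \<in> loop_algebra. loop_aut X = X}"

definition Ltw_pos :: "loop set" where
  "Ltw_pos = Ltw \<inter> sl3_pos"

definition Ltw_zero :: "loop set" where
  "Ltw_zero = Ltw \<inter> sl3_cartan"

definition w_plus :: "nat \<Rightarrow> nat \<Rightarrow> loop" where
  "w_plus a b = loop_tensor (t_plus ^ a * t_minus ^ b) (chev_h1 + chev_h2)"

definition w_minus :: "nat \<Rightarrow> nat \<Rightarrow> loop" where
  "w_minus a b = loop_tensor (t_plus ^ a * t_minus ^ b) (chev_h1 - chev_h2)"

text \<open>
  Linear functionals on \<^const>\<open>Ltw_zero\<close> are represented by functions on the whole type; the values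
  outside \<^const>\<open>Ltw_zero\<close> play no role.
\<close>

definition Ltw_zero_dual :: "(loop \<Rightarrow> complex) set" where
  "Ltw_zero_dual = {\<phi>.
     (\<forall>x\<in>Ltw_zero. \<forall>y\<in>Ltw_zero. \<phi> (x + y) = \<phi> x + \<phi> y) \<and>
     (\<forall>c. \<forall>x\<in>Ltw_zero. \<phi> (loop_scale c x) = c * \<phi> x)}"


subsection \<open>Modules\<close>

text \<open>The values of \<open>act\<close> outside \<^const>\<open>Ltw\<close> play no role.\<close>

locale Ltw_module = vector_space smul
  for smul :: "complex \<Rightarrow> 'v::ab_group_add \<Rightarrow> 'v" +
  fixes act :: "loop \<Rightarrow> 'v \<Rightarrow> 'v"
  assumes act_add_left: "x \<in> Ltw \<Longrightarrow> y \<in> Ltw \<Longrightarrow> act (x + y) v = act x v + act y v"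
    and act_scale_left: "x \<in> Ltw \<Longrightarrow> act (loop_scale c x) v = smul c (act x v)"
    and act_add_right: "x \<in> Ltw \<Longrightarrow> act x (u + v) = act x u + act x v"
    and act_scale_right: "x \<in> Ltw \<Longrightarrow> act x (smul c v) = smul c (act x v)"
    and act_bracket: "x \<in> Ltw \<Longrightarrow> y \<in> Ltw \<Longrightarrow>
      act (lie_bracket x y) v = act x (act y v) - act y (act x v)"
begin

definition submodule :: "'v set \<Rightarrow> bool" where
  "submodule W \<longleftrightarrow> subspace W \<and> (\<forall>x\<in>Ltw. \<forall>w\<in>W. act x w \<in> W)"

definition simple_module :: bool where
  "simple_module \<longleftrightarrow> (UNIV :: 'v set) \<noteq> {0} \<and> (\<forall>W. submodule W \<longrightarrow> W = {0} \<or> W = UNIV)"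

definition generated_by :: "'v \<Rightarrow> bool" where
  "generated_by v \<longleftrightarrow> (\<forall>W. submodule W \<longrightarrow> v \<in> W \<longrightarrow> W = UNIV)"

definition highest_weight_vector :: "(loop \<Rightarrow> complex) \<Rightarrow> 'v \<Rightarrow> bool" where
  "highest_weight_vector \<phi> v \<longleftrightarrow> v \<noteq> 0 \<and> (\<forall>x\<in>Ltw_pos. act x v = 0) \<and>
     (\<forall>w\<in>Ltw_zero. act w v = smul (\<phi> w) v)"

definition finite_dim :: bool where
  "finite_dim \<longleftrightarrow> (\<exists>B. finite B \<and> span B = UNIV)"

end

text \<open>
  The module \<open>V(\<phi>)\<close> is determined up to isomorphism by being simple and generated by a highest
  weight vector of weight \<open>\<phi>\<close>; the predicate says that the module structure given by \<open>smul\<close> and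
  \<open>act\<close> on the type \<open>'v\<close>, with distinguished vector \<open>v\<close>, is a model of it.
\<close>

definition is_simple_highest_weight_module ::
  "(complex \<Rightarrow> 'v::ab_group_add \<Rightarrow> 'v) \<Rightarrow> (loop \<Rightarrow> 'v \<Rightarrow> 'v) \<Rightarrow> (loop \<Rightarrow> complex) \<Rightarrow> 'v \<Rightarrow> bool" where
  "is_simple_highest_weight_module smul act \<phi> v \<longleftrightarrow>
     Ltw_module smul act \<and>
     Ltw_module.simple_module smul act \<and>
     Ltw_module.generated_by smul act v \<and>
     Ltw_module.highest_weight_vector smul act \<phi> v"


subsection \<open>Consistency of the matrix realisation\<close>

lemmas mat3 = vec_eq_iff forall_3 sum_3 matrix_matrix_mult_def transpose_def trace_def
  lie_bracket_def mat_scale_def matrix_unit_def diagram_aut_def diagram_form_def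
  chev_e1_def chev_e2_def chev_f1_def chev_f2_def chev_h1_def chev_h2_def

lemma diagram_form_square: "diagram_form ** diagram_form = (mat 1 :: 'a::comm_ring_1^3^3)"
  by (simp add: mat3 mat_def)

lemma diagram_aut_chevalley:
  "diagram_aut chev_e1 = (chev_e2 :: 'a::comm_ring_1^3^3)"
  "diagram_aut chev_e2 = (chev_e1 :: 'a::comm_ring_1^3^3)"
  "diagram_aut chev_f1 = (chev_f2 :: 'a::comm_ring_1^3^3)"
  "diagram_aut chev_f2 = (chev_f1 :: 'a::comm_ring_1^3^3)"
  "diagram_aut chev_h1 = (chev_h2 :: 'a::comm_ring_1^3^3)"
  "diagram_aut chev_h2 = (chev_h1 :: 'a::comm_ring_1^3^3)"
  by (simp_all add: mat3)

lemma diagram_aut_sl3: "x \<in> sl3 \<Longrightarrow> diagram_aut x \<in> sl3"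
proof -
  assume "x \<in> sl3"
  moreover have "trace (diagram_aut x) = - trace x"
    by (simp add: mat3)
  ultimately show ?thesis
    by (simp add: sl3_def)
qed

lemma diagram_aut_involution: "diagram_aut (diagram_aut x) = x"
  by (simp add: mat3)

lemma diagram_aut_add: "diagram_aut (x + y) = diagram_aut x + diagram_aut y"
  by (simp add: mat3)

lemma diagram_aut_scale: "diagram_aut (mat_scale c x) = mat_scale c (diagram_aut x)"
  by (simp add: mat3)

lemma diagram_aut_bracket:
  "diagram_aut (lie_bracket x y) = lie_bracket (diagram_aut x) (diagram_aut y)"
  by (simp add: mat3 algebra_simps)

lemma sl3_basis:
  assumes "x \<in> sl3"
  shows "x = mat_scale (x$1$2) chev_e1 + mat_scale (x$2$3) chev_e2
    + mat_scale (x$1$3) (lie_bracket chev_e1 chev_e2)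
    + mat_scale (x$2$1) chev_f1 + mat_scale (x$3$2) chev_f2
    + mat_scale (x$3$1) (lie_bracket chev_f2 chev_f1)
    + mat_scale (x$1$1) (lie_bracket chev_e1 chev_f1)
    + mat_scale (- x$3$3) (lie_bracket chev_e2 chev_f2)"
proof -
  have "x$2$2 = - x$1$1 - x$3$3"
    using assms by (simp add: sl3_def trace_def sum_3 eq_neg_iff_add_eq_0 algebra_simps)
  then show ?thesis
    by (simp add: mat3)
qed

lemma sl3_pos_eq:
  "sl3_pos = {mat_scale a chev_e1 + mat_scale b chev_e2 + mat_scale c (lie_bracket chev_e1 chev_e2)
    | a b c. True}"
proof (intro equalityI subsetI)
  fix x :: "'a^3^3" assume "x \<in> sl3_pos"
  then have "x = mat_scale (x$1$2) chev_e1 + mat_scale (x$2$3) chev_e2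
      + mat_scale (x$1$3) (lie_bracket chev_e1 chev_e2)"
    by (simp add: sl3_pos_def mat3)
  then show "x \<in> {mat_scale a chev_e1 + mat_scale b chev_e2
      + mat_scale c (lie_bracket chev_e1 chev_e2) | a b c. True}"
    by blast
qed (auto simp: sl3_pos_def mat3)

lemma diagram_aut_unique:
  fixes \<theta> :: "complex^3^3 \<Rightarrow> complex^3^3"
  assumes add: "\<And>x y. x \<in> sl3 \<Longrightarrow> y \<in> sl3 \<Longrightarrow> \<theta> (x + y) = \<theta> x + \<theta> y"
    and scale: "\<And>c x. x \<in> sl3 \<Longrightarrow> \<theta> (mat_scale c x) = mat_scale c (\<theta> x)"
    and bracket: "\<And>x y. x \<in> sl3 \<Longrightarrow> y \<in> sl3 \<Longrightarrow> \<theta> (lie_bracket x y) = lie_bracket (\<theta> x) (\<theta> y)"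
    and gens: "\<theta> chev_e1 = chev_e2" "\<theta> chev_e2 = chev_e1" "\<theta> chev_f1 = chev_f2" "\<theta> chev_f2 = chev_f1"
    and x: "x \<in> sl3"
  shows "\<theta> x = diagram_aut x"
proof -
  have cl: "chev_e1 \<in> sl3" "chev_e2 \<in> sl3" "chev_f1 \<in> sl3" "chev_f2 \<in> (sl3 :: (complex^3^3) set)"
    by (simp_all add: sl3_def mat3)
  have cb: "lie_bracket a b \<in> sl3" for a b :: "complex^3^3"
    by (simp add: sl3_def mat3 algebra_simps)
  have cs: "mat_scale c a \<in> sl3" if "a \<in> sl3" for c and a :: "complex^3^3"
    using that by (simp add: sl3_def mat3 flip: distrib_left)
  have ca: "a + b \<in> sl3" if "a \<in> sl3" "b \<in> sl3" for a b :: "complex^3^3"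
    using that by (simp add: sl3_def trace_add)
  from sl3_basis[OF x] obtain a1 a2 a3 a4 a5 a6 a7 a8 where
    "x = mat_scale a1 chev_e1 + mat_scale a2 chev_e2 + mat_scale a3 (lie_bracket chev_e1 chev_e2)
      + mat_scale a4 chev_f1 + mat_scale a5 chev_f2 + mat_scale a6 (lie_bracket chev_f2 chev_f1)
      + mat_scale a7 (lie_bracket chev_e1 chev_f1) + mat_scale a8 (lie_bracket chev_e2 chev_f2)"
    by blast
  then show ?thesis
    by (simp only: add scale bracket gens cl cb cs ca diagram_aut_add diagram_aut_scale
        diagram_aut_bracket diagram_aut_chevalley)
qed

lemma laurent_const_simps:
  "laurent_const (a + b) = laurent_const a + laurent_const b"
  "laurent_const (a - b) = laurent_const a - laurent_const b"
  "laurent_const (- a) = - laurent_const a"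
  "laurent_const (a * b) = laurent_const a * laurent_const b"
  "laurent_const 0 = 0"
  "laurent_const 1 = 1"
  by (simp_all add: laurent_const_def mult_single single_add single_diff single_uminus)

lemma lie_bracket_loop_tensor:
  "lie_bracket (loop_tensor P x) (loop_tensor Q y) = loop_tensor (P * Q) (lie_bracket x y)"
  by (simp add: loop_tensor_def mat3 laurent_const_simps algebra_simps)

lemma loop_scale_loop_tensor: "loop_scale c (loop_tensor P x) = loop_tensor P (mat_scale c x)"
  by (simp add: loop_scale_def loop_tensor_def mat3 laurent_const_simps algebra_simps)

lemma laurent_flip_simps:
  "laurent_flip (P + Q) = laurent_flip P + laurent_flip Q"
  "laurent_flip (Poly_Mapping.single m c) = Poly_Mapping.single (- m) c"
  "laurent_flip (t_pow m) = t_pow (- m)"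
  "laurent_flip 0 = 0"
proof -
  show *: "laurent_flip (Poly_Mapping.single m c) = Poly_Mapping.single (- m) c" for m c
    using map_key_single[of uminus "- m" c] by (simp add: laurent_flip_def)
  show "laurent_flip (t_pow m) = t_pow (- m)"
    by (simp add: t_pow_def *)
qed (simp_all add: laurent_flip_def map_key_plus)

lemma trace_loop_tensor: "trace (loop_tensor P x) = P * laurent_const (trace x)"
  by (simp add: loop_tensor_def trace_def sum_3 laurent_const_simps algebra_simps)

lemma loop_algebra_eq_sum:
  "loop_algebra = {\<Sum>m\<in>M. loop_tensor (t_pow m) (x m) | M x. finite M \<and> (\<forall>m\<in>M. x m \<in> sl3)}"
proof (intro equalityI subsetI)
  fix X :: loop
  assume X: "X \<in> loop_algebra"
  define M where "M = (\<Union>i j. Poly_Mapping.keys (X$i$j))"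
  define x :: "int \<Rightarrow> complex^3^3" where "x m = (\<chi> i j. Poly_Mapping.lookup (X$i$j) m)" for m
  have fin: "finite M"
    by (auto simp: M_def)
  have "trace (x m) = Poly_Mapping.lookup (trace X) m" for m
    by (simp add: x_def trace_def sum_3 lookup_add)
  then have sl: "x m \<in> sl3" for m
    using X by (simp add: sl3_def)
  have "X$i$j = (\<Sum>m\<in>M. Poly_Mapping.single m (Poly_Mapping.lookup (X$i$j) m))" for i j
  proof (rule poly_mapping_eqI)
    fix k
    have "k \<notin> M \<Longrightarrow> Poly_Mapping.lookup (X$i$j) k = 0"
      unfolding M_def by (auto simp: in_keys_iff)
    then show "Poly_Mapping.lookup (X$i$j) k =
        Poly_Mapping.lookup (\<Sum>m\<in>M. Poly_Mapping.single m (Poly_Mapping.lookup (X$i$j) m)) k"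
      using fin by (auto simp: lookup_sum lookup_single when_def)
  qed
  then have "X = (\<Sum>m\<in>M. loop_tensor (t_pow m) (x m))"
    by (simp add: vec_eq_iff loop_tensor_def x_def t_pow_def laurent_const_def mult_single)
  with fin sl show "X \<in> {\<Sum>m\<in>M. loop_tensor (t_pow m) (x m) | M x.
      finite M \<and> (\<forall>m\<in>M. x m \<in> sl3)}"
    by blast
next
  fix X :: loop
  assume "X \<in> {\<Sum>m\<in>M. loop_tensor (t_pow m) (x m) | M x. finite M \<and> (\<forall>m\<in>M. x m \<in> sl3)}"
  then obtain M x where X: "X = (\<Sum>m\<in>M. loop_tensor (t_pow m) (x m))"
    and fin: "finite M" and sl: "\<forall>m\<in>M. x m \<in> sl3"
    by blast
  have "\<forall>m\<in>M. trace (loop_tensor (t_pow m) (x m)) = 0"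
    using sl by (simp add: trace_loop_tensor sl3_def laurent_const_simps)
  with fin have "trace (\<Sum>m\<in>M. loop_tensor (t_pow m) (x m)) = 0"
    by (induction M rule: finite_induct) (auto simp: trace_def sum.distrib)
  then show "X \<in> loop_algebra"
    by (simp add: X sl3_def)
qed

lemma laurent_flip_minus: "laurent_flip (P - Q) = laurent_flip P - laurent_flip Q"
  by (metis add_diff_cancel diff_add_cancel laurent_flip_simps(1))

lemma laurent_flip_uminus: "laurent_flip (- P) = - laurent_flip P"
  using laurent_flip_minus[of 0 P] by (simp add: laurent_flip_simps)

lemma laurent_flip_mult: "laurent_flip (P * Q) = laurent_flip P * laurent_flip Q"
proof -
  have sum_monomials: "R = (\<Sum>m\<in>Poly_Mapping.keys R. Poly_Mapping.single m (Poly_Mapping.lookup R m))"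
    for R :: laurent
    by (rule poly_mapping_eqI) (auto simp: lookup_sum lookup_single when_def in_keys_iff)
  have flip_sum: "laurent_flip (\<Sum>m\<in>A. f m) = (\<Sum>m\<in>A. laurent_flip (f m))" for A :: "int set" and f
    by (induction A rule: infinite_finite_induct) (simp_all add: laurent_flip_simps)
  show ?thesis
    (is "?flip (P * Q) = _")
  proof -
    let ?s = "\<lambda>R m. Poly_Mapping.single m (Poly_Mapping.lookup R m) :: laurent"
    let ?s' = "\<lambda>R m. Poly_Mapping.single (- m) (Poly_Mapping.lookup R m) :: laurent"
    have flip: "?flip R = (\<Sum>m\<in>Poly_Mapping.keys R. ?s' R m)" for R
      by (rule trans[OF arg_cong[OF sum_monomials[of R], of laurent_flip]])
         (simp only: flip_sum laurent_flip_simps(2))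
    have "P * Q = (\<Sum>m\<in>Poly_Mapping.keys P. ?s P m) * (\<Sum>k\<in>Poly_Mapping.keys Q. ?s Q k)"
      using sum_monomials[of P] sum_monomials[of Q] by simp
    then have "?flip (P * Q) =
        ?flip (\<Sum>m\<in>Poly_Mapping.keys P. \<Sum>k\<in>Poly_Mapping.keys Q. ?s P m * ?s Q k)"
      by (simp add: sum_product)
    also have "\<dots> = (\<Sum>m\<in>Poly_Mapping.keys P. \<Sum>k\<in>Poly_Mapping.keys Q. ?s' P m * ?s' Q k)"
      by (simp add: flip_sum mult_single laurent_flip_simps)
    also have "\<dots> = ?flip P * ?flip Q"
      by (simp add: flip sum_product)
    finally show ?thesis .
  qed
qed

lemma loop_aut_loop_tensor: "loop_aut (loop_tensor P x) = loop_tensor (laurent_flip P) (diagram_aut x)"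
proof -
  have "laurent_flip (P * laurent_const c) = laurent_flip P * laurent_const c" for c
    by (simp add: laurent_flip_mult laurent_const_def laurent_flip_simps)
  then show ?thesis
    by (simp add: loop_aut_def loop_tensor_def mat3 laurent_const_simps)
qed

corollary loop_aut_t_pow:
  "loop_aut (loop_tensor (t_pow m) x) = loop_tensor (t_pow (- m)) (diagram_aut x)"
  by (simp add: loop_aut_loop_tensor laurent_flip_simps)

lemma loop_aut_bracket: "loop_aut (lie_bracket X Y) = lie_bracket (loop_aut X) (loop_aut Y)"
proof -
  have "map_matrix laurent_flip (lie_bracket X Y) =
      lie_bracket (map_matrix laurent_flip X) (map_matrix laurent_flip Y)"
    by (simp add: mat3 laurent_flip_simps laurent_flip_minus laurent_flip_mult)
  then show ?thesis
    by (simp add: loop_aut_def diagram_aut_bracket)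
qed

lemma Ltw_bracket_closed: "X \<in> Ltw \<Longrightarrow> Y \<in> Ltw \<Longrightarrow> lie_bracket X Y \<in> Ltw"
  by (simp add: Ltw_def loop_aut_bracket) (simp add: sl3_def mat3 algebra_simps)

lemma laurent_flip_t_powers:
  "laurent_flip (t_plus ^ a * t_minus ^ b) = (- 1) ^ b * (t_plus ^ a * t_minus ^ b)"
proof -
  have one: "laurent_flip 1 = 1"
    using laurent_flip_simps(3)[of 0] by (simp add: t_pow_def)
  have p: "laurent_flip (t_plus ^ a) = t_plus ^ a"
    by (induction a)
       (simp_all add: one laurent_flip_mult, simp add: t_plus_def laurent_flip_simps add.commute)
  have "laurent_flip t_minus = - t_minus"
    by (simp add: t_minus_def laurent_flip_minus laurent_flip_simps)
  then have "laurent_flip (t_minus ^ b) = (- 1) ^ b * t_minus ^ b"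
    by (induction b) (simp_all add: one laurent_flip_mult)
  with p show ?thesis
    by (simp add: laurent_flip_mult algebra_simps)
qed

lemma w_in_Ltw_zero: "w_plus a 0 \<in> Ltw_zero" "w_minus a 1 \<in> Ltw_zero"
proof -
  have tr: "trace (chev_h1 + chev_h2 :: complex^3^3) = 0" "trace (chev_h1 - chev_h2 :: complex^3^3) = 0"
    by (simp_all add: mat3)
  have aut: "diagram_aut (chev_h1 + chev_h2) = (chev_h1 + chev_h2 :: complex^3^3)"
    "diagram_aut (chev_h1 - chev_h2) = - (chev_h1 - chev_h2 :: complex^3^3)"
    by (simp_all add: mat3)
  have neg: "loop_tensor (- P) (- x) = loop_tensor P x" for P x
    by (simp add: loop_tensor_def vec_eq_iff laurent_const_simps)
  have diag: "\<forall>i j. i \<noteq> j \<longrightarrow> (chev_h1 + chev_h2 :: complex^3^3)$i$j = 0"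
    "\<forall>i j. i \<noteq> j \<longrightarrow> (chev_h1 - chev_h2 :: complex^3^3)$i$j = 0"
    by (auto simp: chev_h1_def chev_h2_def matrix_unit_def)
  have cartan: "loop_tensor P x \<in> sl3_cartan" if "trace x = 0" "\<forall>i j. i \<noteq> j \<longrightarrow> x$i$j = 0" for P x
    using that by (simp add: sl3_cartan_def sl3_def trace_loop_tensor laurent_const_simps)
                  (simp add: loop_tensor_def laurent_const_simps)
  have "loop_aut (w_plus a 0) = w_plus a 0" "loop_aut (w_minus a 1) = w_minus a 1"
    by (simp_all only: w_plus_def w_minus_def loop_aut_loop_tensor laurent_flip_t_powers aut)
       (simp_all only: power_0 power_one_right mult_1 mult_minus1 neg)
  moreover have "w_plus a 0 \<in> sl3_cartan" "w_minus a 1 \<in> sl3_cartan"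
    by (simp_all only: w_plus_def w_minus_def cartan[OF tr(1) diag(1)] cartan[OF tr(2) diag(2)])
  ultimately show "w_plus a 0 \<in> Ltw_zero" "w_minus a 1 \<in> Ltw_zero"
    by (simp_all add: Ltw_zero_def Ltw_def sl3_cartan_def)
qed

end

theory Submission
  imports Defs "HOL-Computational_Algebra.Fundamental_Theorem_Algebra"
begin

text \<open>
  Writing \<open>P~(t) = P(t^{-1})\<close>, the twisted algebra is spanned by \<open>x(P) = P e_1 + P~ e_2\<close>,
  \<open>y(P) = P f_1 + P~ f_2\<close>, \<open>h(P) = P h_1 + P~ h_2\<close> and the root vectors \<open>z(P)\<close>, \<open>w(P)\<close> in
  positions \<open>(1,3)\<close> and \<open>(3,1)\<close> with entry \<open>P - P~\<close>. Condition (2) says that \<open>psi(P) = \<phi>(h(P))\<close> is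
  \<open>\<nu>_1 P(1) + \<nu>_{-1} P(-1) + \<Sum> P(\<alpha>_i)\<close>. Let \<open>I\<close> be the largest ideal in the kernel of \<open>psi\<close>; by
  simplicity \<open>y(P) v = 0\<close> for \<open>P \<in> I\<close>.

  If the module is finite-dimensional, then \<open>I \<noteq> 0\<close> and every \<open>y(P)\<close> acts nilpotently on \<open>v\<close>. When
  \<open>P^2\<close> and \<open>P P~ Q~\<close> lie in \<open>I\<close>, one has \<open>x(Q) y(P)^r v = r psi(PQ) y(P)^{r-1} v\<close>, whence
  \<open>psi(PQ) = 0\<close>; this makes \<open>I\<close> a radical ideal, so that \<open>psi\<close> is a combination of evaluations. For
  an interpolation idempotent \<open>P\<close> at \<open>\<alpha>\<close>, the \<open>sl_2\<close> computation
  \<open>x(1) y(P)^r v = r (psi(P) - (r-1) s) y(P)^{r-1} v\<close>, where \<open>s = 1/2\<close> if \<open>\<alpha> = \<plusminus>1\<close> and \<open>s = 1\<close>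
  otherwise, gives integrality.

  Conversely, if \<open>psi\<close> has the stated form, the same computation shows that the idempotents act locally
  nilpotently through \<open>y\<close>, hence also through \<open>w\<close>, and finitely many of these operators generate the
  action of the lower triangular part, so the module is finite-dimensional.
\<close>

subsection \<open>Laurent polynomials\<close>

lemma laurent_flip_lookup: "Poly_Mapping.lookup (laurent_flip P) k = Poly_Mapping.lookup P (- k)"
  by (simp add: laurent_flip_def map_key.rep_eq)

lemma laurent_flip_flip [simp]: "laurent_flip (laurent_flip P) = P"
  by (rule poly_mapping_eqI) (simp add: laurent_flip_lookup)

lemma laurent_flip_const [simp]: "laurent_flip (laurent_const c) = laurent_const c"
  by (simp add: laurent_const_def laurent_flip_simps)

lemma laurent_flip_one [simp]: "laurent_flip 1 = 1"
  using laurent_flip_const[of 1] by (simp add: laurent_const_simps)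

lemmas flip_simps = laurent_flip_simps(1,4) laurent_flip_minus laurent_flip_uminus laurent_flip_mult

lemma laurent_numeral: "laurent_const (numeral n) = numeral n"
proof -
  have "laurent_const (of_nat k) = of_nat k" for k
    by (induction k) (simp_all add: laurent_const_simps)
  from this[of "numeral n"] show ?thesis by simp
qed

lemma t_pow_add: "t_pow (m + n) = t_pow m * t_pow n"
  by (simp add: t_pow_def mult_single)

lemma t_pow_0 [simp]: "t_pow 0 = 1"
  by (simp add: t_pow_def)

lemma t_pow_inverse: "t_pow 1 * t_pow (- 1) = 1"
  using t_pow_add[of 1 "- 1"] by simp

text \<open>Zero is the monomial with coefficient 0, so no separate base case occurs.\<close>

lemma laurent_induct [case_names monom add]:
  assumes "\<And>m c. Q (laurent_const c * t_pow m)"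
    and "\<And>P P'. Q P \<Longrightarrow> Q P' \<Longrightarrow> Q (P + P')"
  shows "Q P"
proof -
  have P: "P = (\<Sum>m\<in>Poly_Mapping.keys P. Poly_Mapping.single m (Poly_Mapping.lookup P m))"
    by (rule poly_mapping_eqI) (auto simp: lookup_sum lookup_single when_def in_keys_iff)
  have m: "Q (Poly_Mapping.single m c)" for m c
    using assms(1)[of c m] by (simp add: laurent_const_def t_pow_def mult_single)
  have "Q 0"
    using m[of 0 0] by simp
  then have "Q (\<Sum>m\<in>A. Poly_Mapping.single m (f m))" for A f
    by (induction A rule: infinite_finite_induct) (simp_all add: m assms(2))
  with P show ?thesis by metis
qed

text \<open>Two consecutive exponents are carried together, to serve a three-term recurrence running
  in both directions.\<close>

lemma t_pow_dual_induct:
  assumes "Q (t_pow 0)" "Q (t_pow 1)"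
    and "\<And>m. Q (t_pow m) \<Longrightarrow> Q (t_pow (m + 1)) \<Longrightarrow> Q (t_pow (m + 2))"
    and "\<And>m. Q (t_pow m) \<Longrightarrow> Q (t_pow (m + 1)) \<Longrightarrow> Q (t_pow (m - 1))"
  shows "Q (t_pow m)"
proof -
  have "Q (t_pow m) \<and> Q (t_pow (m + 1))"
  proof (induction m rule: int_induct[where k = 0])
    case base
    then show ?case using assms(1,2) by simp
  next
    case (step1 i)
    then show ?case using assms(3)[of i] by (simp add: add.assoc)
  next
    case (step2 i)
    then show ?case using assms(4)[of i] by simp
  qed
  then show ?thesis ..
qed

section \<open>Evaluation of Laurent polynomials\<close>

definition laurent_eval :: "complex \<Rightarrow> laurent \<Rightarrow> complex" where
  "laurent_eval \<alpha> P = (\<Sum>m\<in>Poly_Mapping.keys P. Poly_Mapping.lookup P m * \<alpha> powi m)"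

lemma laurent_eval_superset:
  assumes "finite A" "Poly_Mapping.keys P \<subseteq> A"
  shows "laurent_eval \<alpha> P = (\<Sum>m\<in>A. Poly_Mapping.lookup P m * \<alpha> powi m)"
  unfolding laurent_eval_def
  by (rule sum.mono_neutral_left) (use assms in \<open>auto simp: in_keys_iff\<close>)

lemma laurent_eval_add [simp]: "laurent_eval \<alpha> (P + Q) = laurent_eval \<alpha> P + laurent_eval \<alpha> Q"
proof -
  let ?A = "Poly_Mapping.keys P \<union> Poly_Mapping.keys Q"
  have "Poly_Mapping.keys (P + Q) \<subseteq> ?A"
    by (rule Poly_Mapping.keys_add)
  then show ?thesis
    by (simp add: laurent_eval_superset[of ?A] lookup_add distrib_right sum.distrib)
qed

lemma laurent_eval_zero [simp]: "laurent_eval \<alpha> 0 = 0"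
  by (simp add: laurent_eval_def)

lemma laurent_eval_single [simp]: "laurent_eval \<alpha> (Poly_Mapping.single m c) = c * \<alpha> powi m"
  by (simp add: laurent_eval_def)

lemma laurent_eval_const [simp]: "laurent_eval \<alpha> (laurent_const c) = c"
  by (simp add: laurent_const_def)

lemma laurent_eval_numeral [simp]: "laurent_eval \<alpha> (numeral n) = numeral n"
  using laurent_eval_const[of \<alpha> "numeral n"] by (simp add: laurent_numeral)

lemma laurent_eval_one [simp]: "laurent_eval \<alpha> 1 = 1"
  using laurent_eval_const[of \<alpha> 1] by (simp add: laurent_const_simps)

lemma laurent_eval_t_pow [simp]: "laurent_eval \<alpha> (t_pow m) = \<alpha> powi m"
  by (simp add: t_pow_def)

text \<open>The point 0 is excluded because \<open>t_pow 1\<close> and \<open>t_pow (- 1)\<close>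
  both evaluate to 0 there, while their product evaluates to 1.\<close>

lemma laurent_eval_mult [simp]:
  assumes "\<alpha> \<noteq> 0"
  shows "laurent_eval \<alpha> (P * Q) = laurent_eval \<alpha> P * laurent_eval \<alpha> Q"
proof (induction P rule: laurent_induct)
  case (monom m c)
  have 1: "laurent_eval \<alpha> (laurent_const c * t_pow m * (laurent_const d * t_pow n))
      = c * \<alpha> powi m * (d * \<alpha> powi n)" for d n
    using assms by (simp add: laurent_const_def t_pow_def mult_single power_int_add)
  have 2: "laurent_eval \<alpha> (laurent_const c * t_pow m) = c * \<alpha> powi m" for c m
    by (simp add: laurent_const_def t_pow_def mult_single)
  show ?case
    by (induction Q rule: laurent_induct) (simp_all only: 1 2 distrib_left laurent_eval_add)
qed (simp add: distrib_right)

lemma laurent_eval_diff [simp]: "laurent_eval \<alpha> (P - Q) = laurent_eval \<alpha> P - laurent_eval \<alpha> Q"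
  using laurent_eval_add[of \<alpha> "P - Q" Q] by simp

lemma laurent_eval_power [simp]: "\<alpha> \<noteq> 0 \<Longrightarrow> laurent_eval \<alpha> (P ^ n) = laurent_eval \<alpha> P ^ n"
  by (induction n) simp_all

lemma laurent_eval_sum: "laurent_eval \<alpha> (\<Sum>i\<in>A. f i) = (\<Sum>i\<in>A. laurent_eval \<alpha> (f i))"
  by (induction A rule: infinite_finite_induct) simp_all

lemma laurent_eval_prod:
  "\<alpha> \<noteq> 0 \<Longrightarrow> laurent_eval \<alpha> (\<Prod>i\<in>A. f i) = (\<Prod>i\<in>A. laurent_eval \<alpha> (f i))"
  by (induction A rule: infinite_finite_induct) simp_all

lemma laurent_eval_flip [simp]: "laurent_eval \<alpha> (laurent_flip P) = laurent_eval (inverse \<alpha>) P"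
proof (induction P rule: laurent_induct)
  case (monom m c)
  show ?case
    by (simp add: laurent_const_def t_pow_def mult_single laurent_flip_simps power_int_minus power_int_inverse)
qed (simp add: flip_simps)

section \<open>Linear factors and interpolation\<close>

definition linear_factor :: "complex \<Rightarrow> laurent" where
  "linear_factor \<alpha> = t_pow 1 - laurent_const \<alpha>"

lemma laurent_eval_linear_factor [simp]: "laurent_eval \<beta> (linear_factor \<alpha>) = \<beta> - \<alpha>"
  by (simp add: linear_factor_def)

text \<open>The remainder theorem. The property is closed under products, so it passes from
  \<open>t_pow 1\<close> and \<open>t_pow (- 1)\<close> to all monomials, and then to sums.\<close>

lemma linear_factor_dvd_diff:
  assumes "\<alpha> \<noteq> 0"
  shows "linear_factor \<alpha> dvd P - laurent_const (laurent_eval \<alpha> P)"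
proof (induction P rule: laurent_induct)
  case (monom m c)
  have mult: "linear_factor \<alpha> dvd P * P' - laurent_const (laurent_eval \<alpha> (P * P'))"
    if "linear_factor \<alpha> dvd P - laurent_const (laurent_eval \<alpha> P)"
      "linear_factor \<alpha> dvd P' - laurent_const (laurent_eval \<alpha> P')" for P P'
  proof -
    have "P * P' - laurent_const (laurent_eval \<alpha> (P * P'))
        = (P - laurent_const (laurent_eval \<alpha> P)) * P'
          + laurent_const (laurent_eval \<alpha> P) * (P' - laurent_const (laurent_eval \<alpha> P'))"
      by (simp add: assms laurent_const_simps algebra_simps)
    then show ?thesis
      using that by (metis dvd_add dvd_mult dvd_mult2)
  qed
  have 1: "linear_factor \<alpha> dvd t_pow 1 - laurent_const (laurent_eval \<alpha> (t_pow 1))"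
    by (simp add: linear_factor_def)
  have "t_pow (- 1) - laurent_const (laurent_eval \<alpha> (t_pow (- 1)))
      = - (laurent_const (inverse \<alpha>) * t_pow (- 1)) * linear_factor \<alpha>"
    using t_pow_inverse assms
    by (simp add: linear_factor_def algebra_simps laurent_const_simps(6) flip: laurent_const_simps(4))
  then have 2: "linear_factor \<alpha> dvd t_pow (- 1) - laurent_const (laurent_eval \<alpha> (t_pow (- 1)))"
    by (metis dvd_triv_right)
  have "linear_factor \<alpha> dvd t_pow m - laurent_const (laurent_eval \<alpha> (t_pow m))"
  proof (induction m rule: int_induct[where k = 0])
    case (step1 i)
    then show ?case using mult[OF _ 1, of "t_pow i"] by (simp only: t_pow_add)
  next
    case (step2 i)
    then show ?case using mult[OF _ 2, of "t_pow i"] by (simp only: t_pow_add[symmetric] diff_conv_add_uminus)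
  qed (simp add: laurent_const_simps)
  then show ?case
    by (intro mult) simp_all
next
  case (add P P')
  then have "linear_factor \<alpha> dvd (P - laurent_const (laurent_eval \<alpha> P)) + (P' - laurent_const (laurent_eval \<alpha> P'))"
    by (rule dvd_add)
  then show ?case
    by (simp add: laurent_const_simps algebra_simps)
qed

text \<open>One factor is split off at a time; the quotient still vanishes at the other points,
  where the removed factor is nonzero.\<close>

lemma prod_linear_factor_dvd:
  assumes "finite S" "0 \<notin> S" "\<And>\<alpha>. \<alpha> \<in> S \<Longrightarrow> laurent_eval \<alpha> P = 0"
  shows "(\<Prod>\<alpha>\<in>S. linear_factor \<alpha>) dvd P"
  using assms
proof (induction S arbitrary: P rule: finite_induct)
  case (insert \<alpha> S)
  have \<alpha>: "\<alpha> \<noteq> 0" using insert.prems by auto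
  have "linear_factor \<alpha> dvd P"
    using linear_factor_dvd_diff[OF \<alpha>, of P] insert.prems by (simp add: laurent_const_simps)
  then obtain P' where P': "P = linear_factor \<alpha> * P'" ..
  have "laurent_eval \<beta> P' = 0" if "\<beta> \<in> S" for \<beta>
  proof -
    have "\<beta> \<noteq> 0" "\<beta> \<noteq> \<alpha>" using that insert by auto
    moreover have "laurent_eval \<beta> P = 0" using that insert.prems by simp
    ultimately show ?thesis by (simp add: P')
  qed
  then have "(\<Prod>\<alpha>\<in>S. linear_factor \<alpha>) dvd P'"
    using insert by blast
  then show ?case
    using insert.hyps by (simp add: P' mult_dvd_mono)
qed simp

text \<open>For \<open>\<alpha>\<close> in \<open>S\<close> this is the Lagrange basis polynomial;
  it is idempotent modulo the functions vanishing on \<open>S\<close>.\<close>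

definition interp :: "complex set \<Rightarrow> complex \<Rightarrow> laurent" where
  "interp S \<alpha> = (\<Prod>\<beta>\<in>S - {\<alpha>}. laurent_const (inverse (\<alpha> - \<beta>)) * linear_factor \<beta>)"

lemma laurent_eval_interp:
  assumes "finite S" "0 \<notin> S" "\<beta> \<in> S"
  shows "laurent_eval \<beta> (interp S \<alpha>) = (if \<beta> = \<alpha> then 1 else 0)"
proof -
  have "\<beta> \<noteq> 0" using assms by auto
  then have "laurent_eval \<beta> (interp S \<alpha>) = (\<Prod>\<gamma>\<in>S - {\<alpha>}. inverse (\<alpha> - \<gamma>) * (\<beta> - \<gamma>))"
    by (simp add: interp_def laurent_eval_prod)
  also have "\<dots> = (if \<beta> = \<alpha> then 1 else 0)"
    using assms by (auto intro!: prod.neutral prod_zero bexI[of _ \<beta>] left_inverse)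
  finally show ?thesis .
qed

text \<open>Powers of \<open>t_plus\<close> and their multiples by \<open>t_minus\<close> span all
  Laurent polynomials. Hence the values prescribed in condition (2) determine
  \<open>psi\<close>.\<close>

lemma laurent_functional_eqI:
  fixes f g :: "laurent \<Rightarrow> complex"
  assumes add: "\<And>P Q. f (P + Q) = f P + f Q" "\<And>P Q. g (P + Q) = g P + g Q"
    and scale: "\<And>c P. f (laurent_const c * P) = c * f P" "\<And>c P. g (laurent_const c * P) = c * g P"
    and plus: "\<And>a. f (t_plus ^ a) = g (t_plus ^ a)"
    and minus: "\<And>a. f (t_plus ^ a * t_minus) = g (t_plus ^ a * t_minus)"
  shows "f P = g P"
proof -
  \<comment> \<open>Quantifying over \<open>a\<close> builds closure under multiplication by
    \<open>t_plus\<close> into the property.\<close>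
  define E where "E P \<longleftrightarrow> (\<forall>a. f (t_plus ^ a * P) = g (t_plus ^ a * P))" for P
  have E_add: "E (P + Q)" if "E P" "E Q" for P Q
    using that by (simp add: E_def distrib_left add)
  have E_scale: "E (laurent_const c * P)" if "E P" for c P
    using that by (simp add: E_def scale mult.left_commute)
  have E_minus: "E (P - Q)" if "E P" "E Q" for P Q
    using E_add[OF that(1) E_scale[OF that(2), of "-1"]] by (simp add: laurent_const_simps)
  have E_plus: "E (t_plus * P)" if "E P" for P
    unfolding E_def
  proof
    fix a show "f (t_plus ^ a * (t_plus * P)) = g (t_plus ^ a * (t_plus * P))"
      using that[unfolded E_def, rule_format, of "Suc a"] by (simp add: ac_simps)
  qed
  have E1: "E 1" by (simp add: E_def plus)
  have Em: "E t_minus" by (simp add: E_def minus)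
  have "t_pow 1 = laurent_const (1/2) * (t_plus * 1 + t_minus)"
  proof -
    have "t_plus * 1 + t_minus = 2 * t_pow 1"
      by (simp add: t_plus_def t_minus_def)
    then have "laurent_const (1/2) * (t_plus * 1 + t_minus) = laurent_const (1/2) * laurent_const 2 * t_pow 1"
      by (simp add: laurent_numeral)
    then show ?thesis by (simp add: laurent_const_simps(6) flip: laurent_const_simps(4))
  qed
  then have Et: "E (t_pow 1)"
    using E_scale[OF E_add[OF E_plus[OF E1] Em]] by metis
  \<comment> \<open>Starting from the exponents 0 and 1, this recurrence reaches every power of t,
    upwards and downwards.\<close>
  have rec: "t_pow (m + 1) = t_plus * t_pow m - t_pow (m - 1)" for m
    by (simp add: t_plus_def distrib_right flip: t_pow_add) (simp add: add.commute)
  have "E (t_pow m)" for m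
  proof (rule t_pow_dual_induct[where Q = E])
    show "E (t_pow (m + 2))" if "E (t_pow m)" "E (t_pow (m + 1))" for m
      using rec[of "m + 1"] E_minus[OF E_plus[OF that(2)] that(1)] by (simp add: add.assoc)
    show "E (t_pow (m - 1))" if "E (t_pow m)" "E (t_pow (m + 1))" for m
      using rec[of m] E_minus[OF E_plus[OF that(1)] that(2)] by simp
  qed (simp_all add: E1 Et)
  then have "E P"
    by (induction P rule: laurent_induct) (auto intro: E_scale E_add)
  from this[unfolded E_def, rule_format, of 0] show ?thesis by simp
qed

section \<open>Ordinary polynomials as Laurent polynomials\<close>

definition laurent_of_poly :: "complex poly \<Rightarrow> laurent" where
  "laurent_of_poly p = (\<Sum>i\<le>degree p. laurent_const (coeff p i) * t_pow (int i))"

lemma laurent_of_poly_bound: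
  "degree p \<le> n \<Longrightarrow> laurent_of_poly p = (\<Sum>i\<le>n. laurent_const (coeff p i) * t_pow (int i))"
  unfolding laurent_of_poly_def
  by (rule sum.mono_neutral_left) (auto simp: coeff_eq_0 laurent_const_simps)

lemma laurent_of_poly_simps:
  "laurent_of_poly 0 = 0" "laurent_of_poly (p + q) = laurent_of_poly p + laurent_of_poly q"
  "laurent_of_poly (smult c p) = laurent_const c * laurent_of_poly p"
  "laurent_of_poly (monom 1 n) = t_pow (int n)"
proof -
  show "laurent_of_poly 0 = 0"
    by (simp add: laurent_of_poly_def laurent_const_simps)
  have "degree (p + q) \<le> max (degree p) (degree q)"
    by (rule degree_add_le_max)
  then show "laurent_of_poly (p + q) = laurent_of_poly p + laurent_of_poly q"
    by (simp add: laurent_of_poly_bound[of _ "max (degree p) (degree q)"] laurent_const_simps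
        distrib_right sum.distrib)
  show "laurent_of_poly (smult c p) = laurent_const c * laurent_of_poly p"
    by (subst laurent_of_poly_bound[OF degree_smult_le])
       (simp add: laurent_of_poly_def laurent_const_simps sum_distrib_left mult.assoc)
  have "laurent_of_poly (monom 1 n) = (\<Sum>i\<le>n. if i = n then t_pow (int n) else 0)"
    unfolding laurent_of_poly_bound[OF degree_monom_le]
    by (rule sum.cong) (auto simp: laurent_const_simps)
  then show "laurent_of_poly (monom 1 n) = t_pow (int n)"
    by simp
qed

text \<open>This case of multiplicativity allows a polynomial to be factored root by root.\<close>

lemma laurent_of_poly_linear_factor:
  "laurent_of_poly ([:- \<alpha>, 1:] * p) = linear_factor \<alpha> * laurent_of_poly p"
proof -
  define n where "n = degree p"
  have "degree ([:- \<alpha>, 1:] * p) \<le> Suc n"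
    using degree_mult_le[of "[:- \<alpha>, 1:]" p] by (simp add: n_def)
  then have "laurent_of_poly ([:- \<alpha>, 1:] * p)
      = (\<Sum>i\<le>Suc n. laurent_const (coeff (pCons 0 p) i - \<alpha> * coeff p i) * t_pow (int i))"
    by (simp add: laurent_of_poly_bound)
  also have "\<dots> = (\<Sum>i\<le>Suc n. laurent_const (coeff (pCons 0 p) i) * t_pow (int i))
      - laurent_const \<alpha> * (\<Sum>i\<le>Suc n. laurent_const (coeff p i) * t_pow (int i))"
    by (simp only: laurent_const_simps left_diff_distrib sum_subtractf sum_distrib_left mult.assoc)
  also have "(\<Sum>i\<le>Suc n. laurent_const (coeff (pCons 0 p) i) * t_pow (int i))
      = t_pow 1 * laurent_of_poly p"
    by (subst sum.atMost_Suc_shift)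
       (simp add: laurent_const_simps laurent_of_poly_def n_def sum_distrib_left t_pow_add algebra_simps)
  also have "(\<Sum>i\<le>Suc n. laurent_const (coeff p i) * t_pow (int i)) = laurent_of_poly p"
    by (rule laurent_of_poly_bound[symmetric]) (simp add: n_def)
  finally show ?thesis
    by (simp add: linear_factor_def algebra_simps)
qed

lemma laurent_eval_t_plus_minus:
  "laurent_eval \<alpha> t_plus = \<alpha> + inverse \<alpha>" "laurent_eval \<alpha> t_minus = \<alpha> - inverse \<alpha>"
  by (simp_all add: t_plus_def t_minus_def power_int_minus)

text \<open>The flip moves evaluation at \<open>\<alpha>\<close> to evaluation at its inverse; the
  fixed points found here are where half-integers will occur.\<close>

lemma inverse_eq_self_iff:
  fixes \<alpha> :: complex
  assumes "\<alpha> \<noteq> 0"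
  shows "inverse \<alpha> = \<alpha> \<longleftrightarrow> \<alpha> = 1 \<or> \<alpha> = - 1"
proof -
  have "inverse \<alpha> = \<alpha> \<longleftrightarrow> \<alpha> * \<alpha> = 1"
    using assms by (auto simp: field_simps)
  then show ?thesis
    using square_eq_1_iff by metis
qed

text \<open>Turns weights on a finite set into an enumeration with repetitions. One enumeration
  serves all \<open>f\<close>, so that it will not depend on the Laurent polynomial being
  evaluated.\<close>

lemma sum_with_multiplicities:
  fixes m :: "'a \<Rightarrow> nat"
  assumes "finite T"
  shows "\<exists>n (\<alpha> :: nat \<Rightarrow> 'a). (\<forall>i\<in>{1..n}. \<alpha> i \<in> T) \<and>
    (\<forall>f :: 'a \<Rightarrow> 'b::semiring_1. (\<Sum>i=1..n. f (\<alpha> i)) = (\<Sum>\<beta>\<in>T. f \<beta> * of_nat (m \<beta>)))"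
  using assms
proof (induction T rule: finite_induct)
  case empty
  then show ?case by (intro exI[of _ 0]) simp
next
  case (insert \<beta> T)
  then obtain n and \<alpha> :: "nat \<Rightarrow> 'a" where \<alpha>: "\<And>i. i \<in> {1..n} \<Longrightarrow> \<alpha> i \<in> T"
    "\<And>f :: 'a \<Rightarrow> 'b. (\<Sum>i=1..n. f (\<alpha> i)) = (\<Sum>\<beta>\<in>T. f \<beta> * of_nat (m \<beta>))"
    by blast
  \<comment> \<open>The enumeration is extended by \<open>m \<beta>\<close> copies of
    \<open>\<beta>\<close>.\<close>
  let ?\<alpha> = "\<lambda>i. if i \<le> n then \<alpha> i else \<beta>"
  have "(\<Sum>i=1..n + m \<beta>. f (?\<alpha> i)) = (\<Sum>\<beta>\<in>insert \<beta> T. f \<beta> * of_nat (m \<beta>))" for f :: "'a \<Rightarrow> 'b"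
  proof -
    have "(\<Sum>i=1..n + m \<beta>. f (?\<alpha> i)) = (\<Sum>i=1..n. f (?\<alpha> i)) + (\<Sum>i=n+1..n + m \<beta>. f (?\<alpha> i))"
      by (rule sum.ub_add_nat) simp
    also have "(\<Sum>i=1..n. f (?\<alpha> i)) = (\<Sum>\<beta>\<in>T. f \<beta> * of_nat (m \<beta>))"
      using \<alpha>(2)[of f] by simp
    also have "(\<Sum>i=n+1..n + m \<beta>. f (?\<alpha> i)) = (\<Sum>i=n+1..n + m \<beta>. f \<beta>)"
      by (rule sum.cong) auto
    finally show ?thesis
      using insert.hyps by (simp add: mult_of_nat_commute add.commute)
  qed
  moreover have "\<forall>i\<in>{1..n + m \<beta>}. ?\<alpha> i \<in> insert \<beta> T"
    using \<alpha>(1) by auto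
  ultimately show ?case
    by (intro exI[of _ "n + m \<beta>"] exI[of _ ?\<alpha>]) blast
qed

subsection \<open>Generators of the twisted loop algebra\<close>

lemma laurent_flip_numeral [simp]: "laurent_flip (numeral n) = numeral n"
  using laurent_flip_const[of "numeral n"] by (simp add: laurent_numeral)

definition loop_x :: "laurent \<Rightarrow> loop" where
  "loop_x P = vector [vector [0, P, 0], vector [0, 0, laurent_flip P], vector [0, 0, 0]]"

definition loop_y :: "laurent \<Rightarrow> loop" where
  "loop_y P = vector [vector [0, 0, 0], vector [P, 0, 0], vector [0, laurent_flip P, 0]]"

definition loop_h :: "laurent \<Rightarrow> loop" where
  "loop_h P = vector [vector [P, 0, 0], vector [0, laurent_flip P - P, 0], vector [0, 0, - laurent_flip P]]"

text \<open>The (1,3) entry of an invariant matrix is odd under the flip. Writing it as a difference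
  lets \<open>P\<close> range freely, but only the odd part of \<open>P\<close> counts; the same
  holds for \<open>loop_w\<close>.\<close>

definition loop_z :: "laurent \<Rightarrow> loop" where
  "loop_z P = vector [vector [0, 0, P - laurent_flip P], vector [0, 0, 0], vector [0, 0, 0]]"

definition loop_w :: "laurent \<Rightarrow> loop" where
  "loop_w P = vector [vector [0, 0, 0], vector [0, 0, 0], vector [P - laurent_flip P, 0, 0]]"

lemmas loop_defs = loop_x_def loop_y_def loop_h_def loop_z_def loop_w_def

lemma loop_in_Ltw [simp]:
  "loop_x P \<in> Ltw" "loop_y P \<in> Ltw" "loop_h P \<in> Ltw" "loop_z P \<in> Ltw" "loop_w P \<in> Ltw"
  by (simp_all add: Ltw_def sl3_def loop_aut_def loop_defs mat3 map_matrix_def flip_simps)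

lemma loop_in_pos_zero:
  "loop_x P \<in> Ltw_pos" "loop_z P \<in> Ltw_pos" "loop_h P \<in> Ltw_zero"
  by (simp_all add: Ltw_pos_def Ltw_zero_def)
     (simp_all add: sl3_pos_def sl3_cartan_def sl3_def loop_defs mat3)

text \<open>The lower triangular part is two-step nilpotent: brackets of the \<open>loop_y\<close>
  are \<open>loop_w\<close>, and these are central in it.\<close>

lemma loop_bracket:
  "lie_bracket (loop_x P) (loop_y Q) = loop_h (P * Q)"
  "lie_bracket (loop_y P) (loop_y Q) = loop_w (laurent_flip P * Q)"
  "lie_bracket (loop_w P) (loop_y Q) = 0"
  "lie_bracket (loop_w P) (loop_w Q) = 0"
  "lie_bracket (loop_z P) (loop_y Q) = loop_x ((P - laurent_flip P) * laurent_flip Q)"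
  "lie_bracket (loop_x P) (loop_w Q) = loop_y (laurent_flip P * (Q - laurent_flip Q))"
  "lie_bracket (loop_z P) (loop_w Q) = loop_h ((P - laurent_flip P) * (Q - laurent_flip Q))"
  "lie_bracket (loop_h P) (loop_y Q) = - loop_y ((2 * P - laurent_flip P) * Q)"
  "lie_bracket (loop_h P) (loop_w Q) = - loop_w ((P + laurent_flip P) * Q)"
  by (simp_all add: loop_defs mat3 flip_simps algebra_simps)

lemma loop_add:
  "loop_x (P + Q) = loop_x P + loop_x Q" "loop_y (P + Q) = loop_y P + loop_y Q"
  "loop_h (P + Q) = loop_h P + loop_h Q" "loop_z (P + Q) = loop_z P + loop_z Q"
  "loop_w (P + Q) = loop_w P + loop_w Q"
  by (simp_all add: loop_defs mat3 flip_simps algebra_simps)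

lemma loop_const_mult:
  "loop_x (laurent_const c * P) = loop_scale c (loop_x P)"
  "loop_y (laurent_const c * P) = loop_scale c (loop_y P)"
  "loop_h (laurent_const c * P) = loop_scale c (loop_h P)"
  "loop_z (laurent_const c * P) = loop_scale c (loop_z P)"
  "loop_w (laurent_const c * P) = loop_scale c (loop_w P)"
  by (simp_all add: loop_scale_def loop_defs mat3 flip_simps algebra_simps)

text \<open>The corner entries are odd, so halving them undoes the doubling in
  \<open>P - laurent_flip P\<close>.\<close>

lemma Ltw_decomp:
  assumes "A \<in> Ltw"
  shows "A = loop_x (A$1$2) + loop_y (A$2$1) + loop_h (A$1$1)
    + loop_z (laurent_const (1/2) * A$1$3) + loop_w (laurent_const (1/2) * A$3$1)"
proof -
  have half: "laurent_const (1/2) * (P + P) = P" for P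
  proof -
    have "laurent_const (1/2) * (P + P) = (laurent_const (1/2) + laurent_const (1/2)) * P"
      by (simp add: algebra_simps)
    then show ?thesis
      by (simp add: laurent_const_simps(6) flip: laurent_const_simps(1))
  qed
  have eq: "loop_aut A = A" and tr: "A$1$1 + A$2$2 + A$3$3 = 0"
    using assms by (simp_all add: Ltw_def sl3_def trace_def sum_3)
  have fl: "laurent_flip (A$1$2) = A$2$3" "laurent_flip (A$2$1) = A$3$2"
    "laurent_flip (A$1$1) = - A$3$3" "laurent_flip (A$1$3) = - A$1$3" "laurent_flip (A$3$1) = - A$3$1"
    by (subst (2) eq[symmetric], simp add: loop_aut_def mat3 map_matrix_def)+
  have "A$2$2 = - A$3$3 - A$1$1"
    using tr by (simp add: algebra_simps eq_neg_iff_add_eq_0)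
  then show ?thesis
    using half by (simp add: loop_defs mat3 flip_simps fl flip: distrib_left)
qed

text \<open>Under the flip \<open>t_plus\<close> is even and \<open>t_minus\<close> is odd, which
  gives \<open>chev_h1\<close> and \<open>chev_h2\<close> equal or opposite coefficients.\<close>

lemma w_plus_minus_eq_loop_h:
  "w_plus a 0 = loop_h (t_plus ^ a)" "w_minus a 1 = loop_h (t_plus ^ a * t_minus)"
  using laurent_flip_t_powers[of a 0] laurent_flip_t_powers[of a 1]
  by (simp_all add: w_plus_def w_minus_def loop_tensor_def loop_h_def mat3 map_matrix_def
      laurent_const_simps laurent_numeral algebra_simps)

subsection \<open>Simple highest weight modules\<close>

locale simple_hw_module = Ltw_module smul act
  for smul :: "complex \<Rightarrow> 'v::ab_group_add \<Rightarrow> 'v" and act :: "loop \<Rightarrow> 'v \<Rightarrow> 'v" +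
  fixes \<phi> :: "loop \<Rightarrow> complex" and v :: 'v
  assumes phi_dual: "\<phi> \<in> Ltw_zero_dual"
    and simple: "simple_module"
    and generated: "generated_by v"
    and hwv: "highest_weight_vector \<phi> v"
begin

abbreviation "X P \<equiv> act (loop_x P)"
abbreviation "Y P \<equiv> act (loop_y P)"
abbreviation "H P \<equiv> act (loop_h P)"
abbreviation "Z P \<equiv> act (loop_z P)"
abbreviation "W P \<equiv> act (loop_w P)"

definition psi :: "laurent \<Rightarrow> complex" where
  "psi P = \<phi> (loop_h P)"

section \<open>Linearity of the operators and of the highest weight\<close>

lemma Ltw_closed: "A \<in> Ltw \<Longrightarrow> B \<in> Ltw \<Longrightarrow> A + B \<in> Ltw" "A \<in> Ltw \<Longrightarrow> loop_scale c A \<in> Ltw"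
proof -
  have "loop_aut (A + B) = loop_aut A + loop_aut B"
    by (simp add: loop_aut_def mat3 map_matrix_def flip_simps)
  then show "A + B \<in> Ltw" if "A \<in> Ltw" "B \<in> Ltw"
    using that by (simp add: Ltw_def sl3_def trace_add)
  show "loop_scale c A \<in> Ltw" if "A \<in> Ltw"
  proof -
    have "trace (loop_scale c A) = laurent_const c * trace A"
      by (simp add: loop_scale_def mat3 algebra_simps)
    moreover have "loop_aut (loop_scale c A) = loop_scale c (loop_aut A)"
      by (simp add: loop_scale_def loop_aut_def mat3 map_matrix_def flip_simps)
    ultimately show ?thesis
      using that by (simp add: Ltw_def sl3_def)
  qed
qed

lemma act_zero_left [simp]: "act 0 w = 0"
proof -
  have "loop_scale 0 (loop_x 0) = 0"
    by (simp add: loop_scale_def mat3 laurent_const_simps)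
  then show ?thesis
    using act_scale_left[of "loop_x 0" 0 w] by simp
qed

lemma act_uminus_left:
  assumes "A \<in> Ltw"
  shows "act (- A) w = - act A w"
proof -
  have "loop_scale (-1) A = - A"
    by (simp add: loop_scale_def mat3 laurent_const_simps)
  then show ?thesis
    using act_scale_left[OF assms, of "-1" w] by simp
qed

lemma act_zero_right [simp]: "A \<in> Ltw \<Longrightarrow> act A 0 = 0"
  using act_scale_right[of A 0 0] by simp

lemma act_uminus_right: "A \<in> Ltw \<Longrightarrow> act A (- w) = - act A w"
  using act_scale_right[of A "-1" w] by simp

lemma act_diff_right: "A \<in> Ltw \<Longrightarrow> act A (u - w) = act A u - act A w"
  using act_add_right[of A u "- w"] by (simp add: act_uminus_right)

lemma act_sum_right: "A \<in> Ltw \<Longrightarrow> act A (\<Sum>i\<in>I. f i) = (\<Sum>i\<in>I. act A (f i))"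
  by (induction I rule: infinite_finite_induct) (simp_all add: act_add_right)

lemmas act_right = act_add_right act_scale_right act_uminus_right act_diff_right

lemma subspace_act_vimage: "A \<in> Ltw \<Longrightarrow> subspace S \<Longrightarrow> subspace {w. act A w \<in> S}"
  by (simp add: subspace_def act_add_right act_scale_right)

lemma op_add:
  "X (P + Q) w = X P w + X Q w" "Y (P + Q) w = Y P w + Y Q w" "H (P + Q) w = H P w + H Q w"
  "Z (P + Q) w = Z P w + Z Q w" "W (P + Q) w = W P w + W Q w"
  by (simp_all add: loop_add act_add_left)

lemma op_const:
  "X (laurent_const c * P) w = smul c (X P w)" "Y (laurent_const c * P) w = smul c (Y P w)"
  "H (laurent_const c * P) w = smul c (H P w)" "Z (laurent_const c * P) w = smul c (Z P w)"
  "W (laurent_const c * P) w = smul c (W P w)"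
  by (simp_all add: loop_const_mult act_scale_left)

lemma op_zero [simp]: "X 0 w = 0" "Y 0 w = 0" "H 0 w = 0" "Z 0 w = 0" "W 0 w = 0"
  using op_const[of 0 0 w] by (simp_all add: laurent_const_simps)

lemma op_diff:
  "Y (P - Q) w = Y P w - Y Q w" "W (P - Q) w = W P w - W Q w"
  using op_add(2)[of "P - Q" Q w] op_add(5)[of "P - Q" Q w] by simp_all

lemma op_sum:
  "Y (\<Sum>i\<in>A. f i) w = (\<Sum>i\<in>A. Y (f i) w)" "W (\<Sum>i\<in>A. f i) w = (\<Sum>i\<in>A. W (f i) w)"
  by (induction A rule: infinite_finite_induct) (simp_all add: op_add)

lemma psi_add [simp]: "psi (P + Q) = psi P + psi Q"
  using phi_dual loop_in_pos_zero(3) by (simp add: psi_def loop_add Ltw_zero_dual_def)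

lemma psi_const [simp]: "psi (laurent_const c * P) = c * psi P"
  using phi_dual loop_in_pos_zero(3) by (simp add: psi_def loop_const_mult Ltw_zero_dual_def)

lemma psi_zero [simp]: "psi 0 = 0"
  using psi_const[of 0 0] by (simp add: laurent_const_simps)

lemma psi_diff [simp]: "psi (P - Q) = psi P - psi Q"
  using psi_add[of "P - Q" Q] by simp

lemma psi_sum: "psi (\<Sum>i\<in>A. f i) = (\<Sum>i\<in>A. psi (f i))"
  by (induction A rule: infinite_finite_induct) simp_all

lemma hwv_simps [simp]: "X P v = 0" "Z P v = 0" "H P v = smul (psi P) v"
  using hwv by (simp_all add: highest_weight_vector_def loop_in_pos_zero psi_def)

lemma v_nonzero: "v \<noteq> 0"
  using hwv by (simp add: highest_weight_vector_def)

lemma act_commute: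
  "A \<in> Ltw \<Longrightarrow> B \<in> Ltw \<Longrightarrow> act A (act B w) = act B (act A w) + act (lie_bracket A B) w"
  by (simp add: act_bracket)

lemma op_commute:
  "X P (Y Q w) = Y Q (X P w) + H (P * Q) w"
  "Y P (Y Q w) = Y Q (Y P w) + W (laurent_flip P * Q) w"
  "W P (Y Q w) = Y Q (W P w)"
  "W P (W Q w) = W Q (W P w)"
  "Z P (Y Q w) = Y Q (Z P w) + X ((P - laurent_flip P) * laurent_flip Q) w"
  "X P (W Q w) = W Q (X P w) + Y (laurent_flip P * (Q - laurent_flip Q)) w"
  "Z P (W Q w) = W Q (Z P w) + H ((P - laurent_flip P) * (Q - laurent_flip Q)) w"
  "H P (Y Q w) = Y Q (H P w) - Y ((2 * P - laurent_flip P) * Q) w"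
  "H P (W Q w) = W Q (H P w) - W ((P + laurent_flip P) * Q) w"
  using act_commute[of "loop_x P" "loop_y Q" w] act_commute[of "loop_y P" "loop_y Q" w]
    act_commute[of "loop_w P" "loop_y Q" w] act_commute[of "loop_w P" "loop_w Q" w]
    act_commute[of "loop_z P" "loop_y Q" w] act_commute[of "loop_x P" "loop_w Q" w]
    act_commute[of "loop_z P" "loop_w Q" w] act_commute[of "loop_h P" "loop_y Q" w]
    act_commute[of "loop_h P" "loop_w Q" w]
  by (simp_all add: loop_bracket act_uminus_left)

lemma submoduleI:
  assumes M: "subspace M"
    and "\<And>P w. w \<in> M \<Longrightarrow> X P w \<in> M" "\<And>P w. w \<in> M \<Longrightarrow> Y P w \<in> M" "\<And>P w. w \<in> M \<Longrightarrow> H P w \<in> M"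
      "\<And>P w. w \<in> M \<Longrightarrow> Z P w \<in> M" "\<And>P w. w \<in> M \<Longrightarrow> W P w \<in> M"
  shows "submodule M"
  unfolding submodule_def
proof (intro conjI ballI M)
  fix A w assume A: "A \<in> Ltw" and w: "w \<in> M"
  show "act A w \<in> M"
    by (subst Ltw_decomp[OF A]) (simp add: act_add_left Ltw_closed subspace_add[OF M] assms w)
qed

section \<open>Subspaces stable under the lower triangular part\<close>

definition lower_stable :: "'v set \<Rightarrow> bool" where
  "lower_stable M \<longleftrightarrow> subspace M \<and> (\<forall>w\<in>M. \<forall>P. Y P w \<in> M \<and> W P w \<in> M)"

text \<open>This is U(n^-) applied to \<open>S\<close>, given as an intersection so that statements
  about it follow from minimality.\<close>

definition lower_hull :: "'v set \<Rightarrow> 'v set" where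
  "lower_hull S = \<Inter>{M. lower_stable M \<and> S \<subseteq> M}"

lemma lower_hull_least: "lower_stable M \<Longrightarrow> S \<subseteq> M \<Longrightarrow> lower_hull S \<subseteq> M"
  by (auto simp: lower_hull_def)

lemma lower_hull_superset: "S \<subseteq> lower_hull S"
  by (auto simp: lower_hull_def)

lemma lower_stable_hull: "lower_stable (lower_hull S)"
  unfolding lower_hull_def lower_stable_def by (auto intro!: subspace_Int simp: subspace_def)

text \<open>The vectors of the hull that the upper and Cartan operators keep inside the hull form a
  lower stable subspace, by the commutation rules. It contains \<open>S\<close>, so it is the whole
  hull.\<close>

lemma submodule_lower_hull:
  assumes S: "\<And>s P. s \<in> S \<Longrightarrow> X P s = 0" "\<And>s P. s \<in> S \<Longrightarrow> Z P s = 0" "\<And>s P. s \<in> S \<Longrightarrow> H P s \<in> lower_hull S"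
  shows "submodule (lower_hull S)"
proof -
  let ?M = "lower_hull S"
  have sub: "subspace ?M" and low: "\<And>w P. w \<in> ?M \<Longrightarrow> Y P w \<in> ?M" "\<And>w P. w \<in> ?M \<Longrightarrow> W P w \<in> ?M"
    using lower_stable_hull[of S] by (auto simp: lower_stable_def)
  define G where "G = {w \<in> ?M. \<forall>P. X P w \<in> ?M \<and> Z P w \<in> ?M \<and> H P w \<in> ?M}"
  have G_sub: "subspace G"
    using sub by (auto simp: G_def subspace_def act_right)
  have "lower_stable G"
    unfolding lower_stable_def
  proof (intro conjI G_sub ballI allI)
    fix w P assume w: "w \<in> G"
    show "Y P w \<in> G" "W P w \<in> G"
      using w sub low by (auto simp: G_def op_commute intro!: subspace_add subspace_diff)
  qed
  moreover have "S \<subseteq> G"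
    using S subsetD[OF lower_hull_superset, of _ S] subspace_0[OF sub] by (auto simp: G_def)
  ultimately have "?M \<subseteq> G"
    by (rule lower_hull_least)
  then show ?thesis
    using sub low by (intro submoduleI) (auto simp: G_def)
qed

text \<open>Serves as an induction principle: a linear property holding at \<open>v\<close> and
  preserved by all \<open>Y P\<close> and \<open>W P\<close> holds on the whole module.\<close>

lemma lower_stable_eq_UNIV:
  assumes "lower_stable M" "v \<in> M"
  shows "M = UNIV"
proof -
  have "v \<in> lower_hull {v}" and sub: "subspace (lower_hull {v})"
    using lower_hull_superset[of "{v}"] lower_stable_hull[of "{v}"] by (auto simp: lower_stable_def)
  then have "smul c v \<in> lower_hull {v}" for c
    using subspace_scale by blast
  then have "submodule (lower_hull {v})"
    by (intro submodule_lower_hull) auto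
  then have "lower_hull {v} = UNIV"
    using generated \<open>v \<in> lower_hull {v}\<close> unfolding generated_by_def by blast
  then show ?thesis
    using lower_hull_least[of M "{v}"] assms by auto
qed

section \<open>Weight spaces and singular vectors\<close>

definition weight_space :: "nat \<Rightarrow> 'v set" where
  "weight_space r = {w. H 1 w = smul (psi 1 - of_nat r) w}"

lemma weight_space_v: "v \<in> weight_space 0"
  by (simp add: weight_space_def)

lemma weight_space_lower:
  assumes "w \<in> weight_space r"
  shows "Y P w \<in> weight_space (r + 1)" "W P w \<in> weight_space (r + 2)"
proof -
  have w: "H 1 w = smul (psi 1 - of_nat r) w"
    using assms by (simp add: weight_space_def)
  have "W (2 * P) w = smul 2 (W P w)"
    using op_const(5)[of 2 P w] by (simp add: laurent_numeral)
  then show "Y P w \<in> weight_space (r + 1)" "W P w \<in> weight_space (r + 2)"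
    by (simp_all add: weight_space_def op_commute w act_right)
      (simp_all add: algebra_simps)
qed

lemma weight_space_Y_power: "(Y P ^^ r) v \<in> weight_space r"
  by (induction r) (use weight_space_v weight_space_lower in auto)

text \<open>Only \<open>\<mu>\<close> has to differ from the other eigenvalues, which may coincide
  among themselves.\<close>

lemma eigenvector_sum_eq_0:
  assumes "finite F" "\<And>i. i \<in> F \<Longrightarrow> H 1 (f i) = smul (m i) (f i)" "\<And>i. i \<in> F \<Longrightarrow> m i \<noteq> \<mu>"
    and "H 1 s = smul \<mu> s" "s = (\<Sum>i\<in>F. f i)"
  shows "s = 0"
  using assms
proof (induction F arbitrary: f s rule: finite_induct)
  case (insert j F)
  \<comment> \<open>Applying \<open>H 1\<close> minus \<open>m j\<close> removes the summand
    \<open>f j\<close> and multiplies \<open>s\<close> by a nonzero scalar.\<close>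
  let ?s = "smul (\<mu> - m j) s" and ?f = "\<lambda>i. smul (m i - m j) (f i)"
  have s_eq: "s = f j + (\<Sum>i\<in>F. f i)"
    using insert by simp
  have "H 1 s = smul (m j) (f j) + (\<Sum>i\<in>F. smul (m i) (f i))"
    using insert.prems(1) by (simp add: s_eq act_right act_sum_right)
  moreover have "?s = H 1 s - smul (m j) s"
    using insert.prems by (simp add: scale_left_diff_distrib)
  ultimately have "?s = smul (m j) (f j) + (\<Sum>i\<in>F. smul (m i) (f i))
      - (smul (m j) (f j) + (\<Sum>i\<in>F. smul (m j) (f i)))"
    by (simp add: s_eq scale_right_distrib scale_sum_right)
  then have s: "?s = (\<Sum>i\<in>F. ?f i)"
    by (simp add: scale_left_diff_distrib sum_subtractf)
  have "?s = 0"
    by (rule insert.IH[OF _ _ _ s]) (use insert.prems in \<open>auto simp: act_right\<close>)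
  then show ?case
    using insert.prems(2)[of j] by auto
qed simp

lemma weight_space_span_eq_0:
  assumes "s \<in> span B" "s \<in> weight_space n" "\<And>b. b \<in> B \<Longrightarrow> \<exists>r. r \<noteq> n \<and> b \<in> weight_space r"
  shows "s = 0"
proof -
  obtain F c where F: "finite F" "F \<subseteq> B" and s: "s = (\<Sum>b\<in>F. smul (c b) b)"
    using assms(1) by (auto simp: span_explicit)
  obtain r where r: "\<And>b. b \<in> B \<Longrightarrow> r b \<noteq> n \<and> b \<in> weight_space (r b)"
    using assms(3) by metis
  show ?thesis
  proof (rule eigenvector_sum_eq_0[OF F(1) _ _ _ s])
    show "H 1 (smul (c b) b) = smul (psi 1 - of_nat (r b)) (smul (c b) b)" if "b \<in> F" for b
      using r[of b] that F by (auto simp: act_right weight_space_def mult.commute)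
    show "psi 1 - of_nat (r b) \<noteq> psi 1 - of_nat n" if "b \<in> F" for b
      using r[of b] that F by auto
  qed (use assms(2) in \<open>simp add: weight_space_def\<close>)
qed

text \<open>A singular vector of weight below the highest one generates a submodule that misses \<open>v\<close>.\<close>

lemma singular_eq_0:
  assumes S: "\<And>s P. s \<in> S \<Longrightarrow> X P s = 0" "\<And>s P. s \<in> S \<Longrightarrow> Z P s = 0" "\<And>s P. s \<in> S \<Longrightarrow> H P s \<in> span S"
    and wt: "\<And>s. s \<in> S \<Longrightarrow> \<exists>r. s \<in> weight_space (Suc r)"
    and s: "s \<in> S"
  shows "s = 0"
proof -
  let ?B = "\<Union>r. weight_space (Suc r)"
  have "span S \<subseteq> lower_hull S"
    using lower_stable_hull[of S] lower_hull_superset[of S] by (intro span_minimal) (auto simp: lower_stable_def)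
  then have "submodule (lower_hull S)"
    using S by (intro submodule_lower_hull) auto
  then have *: "lower_hull S = {0} \<or> lower_hull S = UNIV"
    using simple by (simp add: simple_module_def)
  \<comment> \<open>The weight spaces strictly below that of \<open>v\<close> span a lower stable
    subspace; it confines the hull of \<open>S\<close> and excludes \<open>v\<close>.\<close>
  have "lower_stable (span ?B)"
    unfolding lower_stable_def
  proof (intro conjI ballI allI subspace_span)
    fix w P assume w: "w \<in> span ?B"
    have "?B \<subseteq> {w. Y P w \<in> span ?B}" "?B \<subseteq> {w. W P w \<in> span ?B}"
      using weight_space_lower by (fastforce intro!: span_base)+
    then have "span ?B \<subseteq> {w. Y P w \<in> span ?B}" "span ?B \<subseteq> {w. W P w \<in> span ?B}"
      by (simp_all only: span_minimal[OF _ subspace_act_vimage[OF loop_in_Ltw(2) subspace_span]]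
          span_minimal[OF _ subspace_act_vimage[OF loop_in_Ltw(5) subspace_span]])
    then show "Y P w \<in> span ?B" "W P w \<in> span ?B"
      using w by auto
  qed
  moreover have "S \<subseteq> span ?B"
    using wt by (fastforce intro: span_base)
  ultimately have "lower_hull S \<subseteq> span ?B"
    by (rule lower_hull_least)
  moreover have "v \<notin> span ?B"
    using weight_space_span_eq_0[OF _ weight_space_v] v_nonzero by blast
  ultimately have "lower_hull S = {0}"
    using * by auto
  then show ?thesis
    using s lower_hull_superset[of S] by auto
qed

section \<open>The largest ideal in the kernel of \<open>psi\<close>\<close>

definition rad :: "laurent \<Rightarrow> bool" where
  "rad P \<longleftrightarrow> (\<forall>Q. psi (P * Q) = 0)"

lemma rad_diff: "rad P \<Longrightarrow> rad Q \<Longrightarrow> rad (P - Q)"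
  by (simp add: rad_def left_diff_distrib)

lemma rad_mult: "rad P \<Longrightarrow> rad (P * Q)"
  by (simp add: rad_def mult.assoc)

lemma rad_dvd: "rad P \<Longrightarrow> P dvd Q \<Longrightarrow> rad Q"
  by (auto simp: rad_mult)

lemma rad_psi: "rad P \<Longrightarrow> psi P = 0"
  unfolding rad_def using mult_1_right[of P] by metis

text \<open>These vectors are singular: \<open>X Q\<close> sends \<open>Y P v\<close> to
  \<open>psi (Q * P)\<close> times \<open>v\<close>, which is zero, and \<open>Z Q\<close> produces
  some \<open>X\<close> applied to \<open>v\<close>.\<close>

lemma rad_Y_v:
  assumes "rad P"
  shows "Y P v = 0"
proof (rule singular_eq_0[where S = "{Y P v | P. rad P}"])
  fix s Q assume "s \<in> {Y P v | P. rad P}"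
  then obtain P where P: "rad P" and s: "s = Y P v"
    by auto
  have "rad ((2 * Q - laurent_flip Q) * P)"
    using rad_mult[OF P] by (metis mult.commute)
  then have "Y P v \<in> span {Y P v | P. rad P}" "Y ((2 * Q - laurent_flip Q) * P) v \<in> span {Y P v | P. rad P}"
    using P by (blast intro: span_base)+
  then show "H Q s \<in> span {Y P v | P. rad P}"
    by (simp add: s op_commute act_right span_diff span_scale)
  show "X Q s = 0" "Z Q s = 0"
    using rad_psi[OF rad_mult[OF P, of Q]] by (simp_all add: s op_commute mult.commute)
  show "\<exists>r. s \<in> weight_space (Suc r)"
    using weight_space_lower(1)[OF weight_space_v, of P] s by auto
qed (use assms in auto)

text \<open>Only the odd part of \<open>P\<close> enters \<open>W P\<close>. Here \<open>X Q\<close>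
  produces a vector covered by \<open>rad_Y_v\<close>, and \<open>Z Q\<close> a value of
  \<open>psi\<close> on the ideal.\<close>

lemma rad_W_v:
  assumes "rad (P - laurent_flip P)"
  shows "W P v = 0"
proof (rule singular_eq_0[where S = "{W P v | P. rad (P - laurent_flip P)}"])
  fix s Q assume "s \<in> {W P v | P. rad (P - laurent_flip P)}"
  then obtain P where P: "rad (P - laurent_flip P)" and s: "s = W P v"
    by auto
  have "(Q + laurent_flip Q) * P - laurent_flip ((Q + laurent_flip Q) * P)
      = (P - laurent_flip P) * (Q + laurent_flip Q)"
    by (simp add: flip_simps algebra_simps)
  then have 1: "rad ((Q + laurent_flip Q) * P - laurent_flip ((Q + laurent_flip Q) * P))"
    using rad_mult[OF P] by simp
  have 2: "Y (laurent_flip Q * (P - laurent_flip P)) v = 0"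
    using rad_Y_v[OF rad_mult[OF P, of "laurent_flip Q"]] by (simp add: mult.commute)
  have "W P v \<in> span {W P v | P. rad (P - laurent_flip P)}"
    "W ((Q + laurent_flip Q) * P) v \<in> span {W P v | P. rad (P - laurent_flip P)}"
    using P 1 by (blast intro: span_base)+
  then show "H Q s \<in> span {W P v | P. rad (P - laurent_flip P)}"
    by (simp add: s op_commute act_right span_diff span_scale)
  show "X Q s = 0" "Z Q s = 0"
    using 2 rad_psi[OF rad_mult[OF P, of "Q - laurent_flip Q"]]
    by (simp_all add: s op_commute mult.commute[of "Q - laurent_flip Q"])
  show "\<exists>r. s \<in> weight_space (Suc r)"
    using weight_space_lower(2)[OF weight_space_v, of P] s by auto
qed (use assms in auto)

text \<open>\<open>S\<close> measures how far \<open>P\<close> is from being an eigenvector of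
  multiplication by \<open>2 * R - laurent_flip R\<close>. The operator in \<open>W\<close> is the
  commutator of \<open>Y S\<close> with \<open>Y P\<close>; both kill \<open>v\<close>, hence
  \<open>Y S\<close> kills all the powers.\<close>

lemma H_Y_power:
  assumes S: "S = (2 * R - laurent_flip R) * P - laurent_const k * P"
    and Y: "Y S v = 0" and W: "W (laurent_flip S * P) v = 0"
  shows "H R ((Y P ^^ j) v) = smul (psi R - of_nat j * k) ((Y P ^^ j) v)"
proof -
  have S_pow: "Y S ((Y P ^^ j) v) = 0 \<and> W (laurent_flip S * P) ((Y P ^^ j) v) = 0" for j
    by (induction j) (simp_all add: Y W op_commute)
  have "H R (Y P w) = Y P (H R w) - (Y S w + smul k (Y P w))" for w
    by (simp add: op_commute(8) S op_diff op_const)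
  then show ?thesis
    using S_pow by (induction j) (simp_all add: act_right, simp add: algebra_simps)
qed

text \<open>The usual sl_2 computation: moving \<open>X Q\<close> to the right leaves
  \<open>H (P * Q)\<close> on each lower power, and the eigenvalues
  \<open>psi (P * Q) - i * k\<close> for \<open>i \<le> j\<close> add up to the coefficient.\<close>

lemma X_Y_power:
  assumes S: "S = (2 * (P * Q) - laurent_flip (P * Q)) * P - laurent_const k * P"
    and Y: "Y S v = 0" and W: "W (laurent_flip S * P) v = 0"
  shows "X Q ((Y P ^^ Suc j) v)
    = smul (of_nat (Suc j) * psi (P * Q) - k * (of_nat (Suc j) * of_nat j / 2)) ((Y P ^^ j) v)"
proof (induction j)
  case (Suc j)
  have "X Q ((Y P ^^ Suc (Suc j)) v) = Y P (X Q ((Y P ^^ Suc j) v)) + H (P * Q) ((Y P ^^ Suc j) v)"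
    by (simp add: op_commute(1) mult.commute)
  then show ?case
    unfolding Suc.IH H_Y_power[OF S Y W]
    by (simp add: act_right flip: scale_left_distrib) (simp add: field_simps)
qed (simp add: op_commute(1) mult.commute)

subsection \<open>Highest weights with finite support\<close>

text \<open>Says that \<open>psi\<close> depends only on values on \<open>S\<close>, without
  derivatives. Points of weight zero are allowed, so 1 and -1 can always be included; closure under
  inverses makes the flip act on functions on \<open>S\<close>.\<close>

definition supported :: "complex set \<Rightarrow> bool" where
  "supported S \<longleftrightarrow> finite S \<and> 0 \<notin> S \<and> inverse ` S \<subseteq> S \<and>
    (\<forall>P. (\<forall>\<alpha>\<in>S. laurent_eval \<alpha> P = 0) \<longrightarrow> rad P)"

text \<open>On \<open>S\<close>, with \<open>P = interp S \<alpha>\<close>, the product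
  \<open>(2 * P - laurent_flip P) * P\<close> equals \<open>2 * step \<alpha>\<close> times
  \<open>P\<close>: the two terms overlap only when \<open>\<alpha>\<close> is its own
  inverse.\<close>

definition step :: "complex \<Rightarrow> complex" where
  "step \<alpha> = (if inverse \<alpha> = \<alpha> then 1 / 2 else 1)"

lemma rad_supported:
  assumes "supported S" "\<And>\<alpha>. \<alpha> \<in> S \<Longrightarrow> laurent_eval \<alpha> P = 0"
  shows "rad P"
  using assms by (simp add: supported_def)

lemma supported_inverse: "supported S \<Longrightarrow> \<alpha> \<in> S \<Longrightarrow> inverse \<alpha> \<in> S"
  by (auto simp: supported_def)

lemma supported_nonzero: "supported S \<Longrightarrow> \<alpha> \<in> S \<Longrightarrow> \<alpha> \<noteq> 0"
  by (auto simp: supported_def)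

lemma supported_finite: "supported S \<Longrightarrow> finite S"
  by (simp add: supported_def)

lemma eval_interp_supported:
  "supported S \<Longrightarrow> \<beta> \<in> S \<Longrightarrow> laurent_eval \<beta> (interp S \<alpha>) = (if \<beta> = \<alpha> then 1 else 0)"
  by (simp add: supported_def laurent_eval_interp)

lemma eval_interp_sum:
  assumes "supported S" "\<beta> \<in> S"
  shows "laurent_eval \<beta> (\<Sum>\<alpha>\<in>S. laurent_const (f \<alpha>) * interp S \<alpha>) = f \<beta>"
  using assms supported_nonzero[OF assms] supported_finite[OF assms(1)]
  by (simp add: laurent_eval_sum eval_interp_supported if_distrib cong: if_cong)

text \<open>The difference of \<open>P\<close> and its Lagrange interpolant vanishes on
  \<open>S\<close>, so \<open>psi\<close> kills it.\<close>

lemma psi_eq_sum: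
  assumes S: "supported S"
  shows "psi P = (\<Sum>\<alpha>\<in>S. laurent_eval \<alpha> P * psi (interp S \<alpha>))"
proof -
  let ?P = "\<Sum>\<alpha>\<in>S. laurent_const (laurent_eval \<alpha> P) * interp S \<alpha>"
  have "rad (P - ?P)"
    by (rule rad_supported[OF S]) (simp add: eval_interp_sum[OF S])
  then have "psi P = psi ?P"
    using rad_psi by fastforce
  then show ?thesis
    by (simp add: psi_sum)
qed

lemma psi_interp_mult:
  assumes S: "supported S" and \<alpha>: "\<alpha> \<in> S"
  shows "psi (interp S \<alpha> * Q) = laurent_eval \<alpha> Q * psi (interp S \<alpha>)"
proof -
  have "psi (interp S \<alpha> * Q)
      = (\<Sum>\<beta>\<in>S. if \<beta> = \<alpha> then laurent_eval \<alpha> Q * psi (interp S \<alpha>) else 0)"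
    unfolding psi_eq_sum[OF S, of "interp S \<alpha> * Q"]
    by (rule sum.cong) (auto simp: supported_nonzero[OF S] eval_interp_supported[OF S])
  then show ?thesis
    using \<alpha> supported_finite[OF S] by simp
qed

text \<open>Supplies the two vanishing hypotheses of \<open>H_Y_power\<close> and
  \<open>X_Y_power\<close> for an error term vanishing on \<open>S\<close>.\<close>

lemma rad_supported_Y_W:
  assumes S: "supported S" and P: "\<And>\<beta>. \<beta> \<in> S \<Longrightarrow> laurent_eval \<beta> P = 0"
  shows "Y P v = 0" "W (laurent_flip P * Q) v = 0"
  using P supported_nonzero[OF S] supported_inverse[OF S]
  by (auto intro!: rad_Y_v rad_W_v rad_supported[OF S] simp: flip_simps)

lemma H_interp_power:
  assumes S: "supported S" and \<alpha>: "\<alpha> \<in> S"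
  shows "\<exists>c. H R ((Y (interp S \<alpha>) ^^ j) v) = smul c ((Y (interp S \<alpha>) ^^ j) v)"
proof -
  let ?k = "2 * laurent_eval \<alpha> R - laurent_eval (inverse \<alpha>) R"
  let ?S = "(2 * R - laurent_flip R) * interp S \<alpha> - laurent_const ?k * interp S \<alpha>"
  have "laurent_eval \<beta> ?S = 0" if "\<beta> \<in> S" for \<beta>
    using that eval_interp_supported[OF S that, of \<alpha>] supported_nonzero[OF S that]
    by simp
  then show ?thesis
    using H_Y_power[OF refl rad_supported_Y_W[OF S]] by blast
qed

text \<open>\<open>X_Y_power\<close> with
  \<open>k = 2 * step \<alpha> * laurent_eval \<alpha> Q\<close>; the error term then vanishes on
  \<open>S\<close>.\<close>

lemma X_interp_power:
  assumes S: "supported S" and \<alpha>: "\<alpha> \<in> S"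
  shows "X Q ((Y (interp S \<alpha>) ^^ Suc j) v)
    = smul (laurent_eval \<alpha> Q * of_nat (Suc j) * (psi (interp S \<alpha>) - step \<alpha> * of_nat j))
        ((Y (interp S \<alpha>) ^^ j) v)"
proof -
  let ?P = "interp S \<alpha>"
  let ?k = "2 * step \<alpha> * laurent_eval \<alpha> Q"
  let ?S = "(2 * (?P * Q) - laurent_flip (?P * Q)) * ?P - laurent_const ?k * ?P"
  have "laurent_eval \<beta> ?S = 0" if "\<beta> \<in> S" for \<beta>
    using that eval_interp_supported[OF S that, of \<alpha>] supported_nonzero[OF S that]
      eval_interp_supported[OF S supported_inverse[OF S that], of \<alpha>]
    by (simp add: step_def laurent_flip_mult)
  then have "X Q ((Y ?P ^^ Suc j) v)
    = smul (of_nat (Suc j) * psi (?P * Q) - ?k * (of_nat (Suc j) * of_nat j / 2)) ((Y ?P ^^ j) v)"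
    using X_Y_power[OF refl rad_supported_Y_W[OF S]] by blast
  also have "of_nat (Suc j) * psi (?P * Q) - ?k * (of_nat (Suc j) * of_nat j / 2)
      = laurent_eval \<alpha> Q * of_nat (Suc j) * (psi ?P - step \<alpha> * of_nat j)"
    unfolding psi_interp_mult[OF S \<alpha>] by (simp add: field_simps)
  finally show ?thesis .
qed

subsection \<open>Finite-dimensional modules\<close>

lemma finite_dim_dependent:
  fixes f :: "nat \<Rightarrow> 'v"
  assumes "finite_dim"
  shows "\<exists>n. f n \<in> span (f ` {..<n})"
proof (rule ccontr)
  assume "\<not> ?thesis"
  then have f: "f n \<notin> span (f ` {..<n})" for n by auto
  have ind: "independent (f ` {..<n}) \<and> card (f ` {..<n}) = n" for n
  proof (induction n)
    case (Suc n)
    have "f n \<notin> f ` {..<n}"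
      by (rule contra_subsetD[OF span_superset f])
    then show ?case
      using Suc f[of n] by (simp add: lessThan_Suc independent_insertI)
  qed (simp add: independent_empty)
  obtain B where B: "finite B" "span B = UNIV"
    using assms by (auto simp: finite_dim_def)
  have "card (f ` {..<Suc (card B)}) \<le> card B"
    using independent_span_bound[OF B(1) conjunct1[OF ind[of "Suc (card B)"]]] B(2) by simp
  then show False
    using ind[of "Suc (card B)"] by simp
qed

text \<open>The powers applied to \<open>v\<close> have pairwise different weights, so one that
  depends linearly on its predecessors is zero.\<close>

lemma finite_dim_nilpotent:
  assumes "finite_dim"
  obtains j where "(Y P ^^ j) v \<noteq> 0" "(Y P ^^ Suc j) v = 0"
proof -
  obtain n where n: "(Y P ^^ n) v \<in> span ((\<lambda>i. (Y P ^^ i) v) ` {..<n})"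
    using finite_dim_dependent[OF assms, of "\<lambda>i. (Y P ^^ i) v"] by blast
  have "(Y P ^^ n) v = 0"
    by (rule weight_space_span_eq_0[OF n weight_space_Y_power]) (use weight_space_Y_power in force)
  then have L: "(Y P ^^ (LEAST n. (Y P ^^ n) v = 0)) v = 0"
    by (rule LeastI)
  obtain j where j: "(LEAST n. (Y P ^^ n) v = 0) = Suc j"
    using L v_nonzero by (cases "LEAST n. (Y P ^^ n) v = 0") auto
  have "(Y P ^^ j) v \<noteq> 0"
    using not_less_Least[of j "\<lambda>n. (Y P ^^ n) v = 0"] j by simp
  then show thesis
    using that L j by metis
qed

text \<open>The hypotheses make \<open>X_Y_power\<close> applicable with \<open>k = 0\<close>. At
  the last nonzero power it reads \<open>0 = (j + 1) psi (P * Q)\<close> times a nonzero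
  vector.\<close>

lemma radical_step:
  assumes fd: "finite_dim" and sq: "rad (P * P)" and PQ: "rad (P * laurent_flip P * laurent_flip Q)"
  shows "psi (P * Q) = 0"
proof -
  let ?S = "(2 * (P * Q) - laurent_flip (P * Q)) * P - laurent_const 0 * P"
  have S: "?S = P * P * (2 * Q) - P * laurent_flip P * laurent_flip Q"
    by (simp add: laurent_const_simps flip_simps algebra_simps)
  have Y: "Y ?S v = 0"
    unfolding S by (rule rad_Y_v[OF rad_diff[OF rad_mult[OF sq] PQ]])
  \<comment> \<open>\<open>rad_W_v\<close> asks for the odd part, whose terms are multiples of the
    two given members of the ideal.\<close>
  have S': "laurent_flip ?S * P - laurent_flip (laurent_flip ?S * P)
     = P * laurent_flip P * laurent_flip Q * (2 * laurent_flip P + laurent_flip P)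
      - P * P * (Q * laurent_flip P) - P * P * (2 * Q * laurent_flip P)"
    by (simp add: laurent_const_simps flip_simps algebra_simps)
  have W: "W (laurent_flip ?S * P) v = 0"
    by (rule rad_W_v, unfold S', rule rad_diff[OF rad_diff[OF rad_mult[OF PQ] rad_mult[OF sq]] rad_mult[OF sq]])
  obtain j where j: "(Y P ^^ j) v \<noteq> 0" "(Y P ^^ Suc j) v = 0"
    using finite_dim_nilpotent[OF fd] .
  then show ?thesis
    using X_Y_power[OF refl Y W, of j] by (simp del: funpow.simps of_nat_Suc)
qed

text \<open>Both hypotheses survive replacing \<open>P\<close> by \<open>P * R\<close>, so
  \<open>radical_step\<close> applies to every multiple.\<close>

lemma rad_step:
  assumes "finite_dim" "rad (P * P)" "rad (P * laurent_flip P * laurent_flip Q)"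
  shows "rad (P * Q)"
  unfolding rad_def
proof
  fix R
  have "psi (P * R * Q) = 0"
  proof (rule radical_step[OF assms(1)])
    show "rad (P * R * (P * R))"
      using rad_mult[OF assms(2), of "R * R"] by (simp add: ac_simps)
    show "rad (P * R * laurent_flip (P * R) * laurent_flip Q)"
      using rad_mult[OF assms(3), of "R * laurent_flip R"] by (simp add: flip_simps ac_simps)
  qed
  then show "psi (P * Q * R) = 0"
    by (simp add: ac_simps)
qed

lemma flip_linear_factor:
  assumes "\<alpha> \<noteq> 0"
  shows "linear_factor (inverse \<alpha>) dvd laurent_flip (linear_factor \<alpha>)"
proof
  have "laurent_const \<alpha> * laurent_const (inverse \<alpha>) = 1"
    using assms by (simp add: laurent_const_simps(6) flip: laurent_const_simps(4))
  then show "laurent_flip (linear_factor \<alpha>) = linear_factor (inverse \<alpha>) * (- laurent_const \<alpha> * t_pow (- 1))"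
    using t_pow_inverse by (simp add: linear_factor_def flip_simps laurent_flip_simps(3) algebra_simps)
qed

text \<open>Removes a repeated factor from a member of the ideal. The partner \<open>Q\<close> in
  \<open>rad_step\<close> is chosen so that a factor at \<open>\<alpha>\<close> divides the flipped
  part: 1 if \<open>\<alpha>\<close> is its own inverse, else the factor at the inverse.\<close>

lemma rad_linear_factor_square:
  assumes fd: "finite_dim" and \<alpha>: "\<alpha> \<noteq> 0" and sq: "rad (linear_factor \<alpha> * linear_factor \<alpha> * q)"
  shows "rad (linear_factor \<alpha> * q)"
proof -
  let ?P = "linear_factor \<alpha> * q"
  have PP: "rad (?P * ?P)"
    using rad_mult[OF sq, of q] by (simp add: ac_simps)
  show ?thesis
  proof (cases "inverse \<alpha> = \<alpha>")
    case True
    then have "linear_factor \<alpha> dvd laurent_flip ?P"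
      using flip_linear_factor[OF \<alpha>] by (simp add: laurent_flip_mult)
    then have "linear_factor \<alpha> * linear_factor \<alpha> * q dvd ?P * laurent_flip ?P * laurent_flip 1"
      using mult_dvd_mono[of "linear_factor \<alpha> * q" ?P "linear_factor \<alpha>"] by (simp add: ac_simps)
    then show ?thesis
      using rad_step[OF fd PP rad_dvd[OF sq], of 1] by simp
  next
    case False
    let ?Q = "linear_factor (inverse \<alpha>)"
    have "linear_factor \<alpha> dvd laurent_flip ?P * laurent_flip ?Q"
      using flip_linear_factor[of "inverse \<alpha>"] \<alpha> by simp
    then have "linear_factor \<alpha> * linear_factor \<alpha> * q dvd ?P * laurent_flip ?P * laurent_flip ?Q"
      using mult_dvd_mono[of "linear_factor \<alpha> * q" ?P "linear_factor \<alpha>"] by (simp add: ac_simps)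
    then have "rad (?P * ?Q)"
      using rad_step[OF fd PP rad_dvd[OF sq]] by simp
    moreover have "rad (?P * linear_factor \<alpha>)"
      using sq by (simp add: ac_simps)
    \<comment> \<open>The two linear factors are coprime: they differ by a nonzero constant.\<close>
    ultimately have "rad (?P * ?Q - ?P * linear_factor \<alpha>)"
      by (rule rad_diff)
    also have "?P * ?Q - ?P * linear_factor \<alpha> = ?P * laurent_const (\<alpha> - inverse \<alpha>)"
      by (simp add: linear_factor_def laurent_const_simps flip: right_diff_distrib)
    finally have "rad (?P * laurent_const (\<alpha> - inverse \<alpha>) * laurent_const (inverse (\<alpha> - inverse \<alpha>)))"
      by (rule rad_mult)
    then show ?thesis
      using False by (simp add: mult.assoc laurent_const_simps(6) flip: laurent_const_simps(4))
  qed
qed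

text \<open>Replaces \<open>p\<close> by a squarefree product. The spectator \<open>q\<close> is
  arbitrary, so that a root factor split off from \<open>p\<close> can be moved into it before the
  induction hypothesis is used.\<close>

lemma rad_poly:
  assumes fd: "finite_dim"
  shows "p \<noteq> 0 \<Longrightarrow> rad (laurent_of_poly p * q)
    \<Longrightarrow> \<exists>S. finite S \<and> 0 \<notin> S \<and> rad ((\<Prod>\<alpha>\<in>S. linear_factor \<alpha>) * q)"
proof (induction "degree p" arbitrary: p q)
  case 0
  then obtain c where c: "p = [:c:]" "c \<noteq> 0"
    by (metis degree_eq_zeroE pCons_eq_0_iff)
  then have "rad (laurent_const c * q * laurent_const (inverse c))"
    using rad_mult[OF 0(3)] by (simp add: laurent_of_poly_def)
  also have "laurent_const c * q * laurent_const (inverse c) = q"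
    using c(2) by (simp add: mult.assoc mult.left_commute[of _ q] laurent_const_simps(6)
        flip: laurent_const_simps(4))
  finally show ?case
    by (intro exI[of _ "{}"]) simp
next
  case (Suc n)
  obtain \<alpha> where "poly p \<alpha> = 0"
    using fundamental_theorem_of_algebra[of p] Suc(2) by (auto simp: constant_degree)
  then obtain p' where p: "p = [:- \<alpha>, 1:] * p'"
    by (auto simp: poly_eq_0_iff_dvd)
  then have p': "p' \<noteq> 0" "n = degree p'"
    using Suc(2,3) by (auto simp del: mult_pCons_left simp: degree_mult_eq)
  obtain S where S: "finite S" "0 \<notin> S" "rad ((\<Prod>\<alpha>\<in>S. linear_factor \<alpha>) * (linear_factor \<alpha> * q))"
    using Suc(1)[OF p'(2,1), of "linear_factor \<alpha> * q"] Suc(4)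
    unfolding p laurent_of_poly_linear_factor by (auto simp: ac_simps)
  consider "\<alpha> = 0" | "\<alpha> \<noteq> 0" "\<alpha> \<in> S" | "\<alpha> \<noteq> 0" "\<alpha> \<notin> S" by blast
  then show ?case
  proof cases
    case 1
    \<comment> \<open>A root at zero contributes the unit \<open>t_pow 1\<close>, which is
      cancelled.\<close>
    have "(\<Prod>\<alpha>\<in>S. linear_factor \<alpha>) * (linear_factor \<alpha> * q) * t_pow (- 1)
        = (\<Prod>\<alpha>\<in>S. linear_factor \<alpha>) * q * (t_pow 1 * t_pow (- 1))"
      by (simp add: 1 linear_factor_def laurent_const_simps ac_simps)
    also have "\<dots> = (\<Prod>\<alpha>\<in>S. linear_factor \<alpha>) * q"
      by (simp only: t_pow_inverse mult_1_right)
    finally have "rad ((\<Prod>\<alpha>\<in>S. linear_factor \<alpha>) * q)"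
      using rad_mult[OF S(3), of "t_pow (- 1)"] by argo
    with S show ?thesis by blast
  next
    case 2
    \<comment> \<open>Here the factor at \<open>\<alpha>\<close> occurs twice, once in the product
      and once in front of \<open>q\<close>.\<close>
    have S': "(\<Prod>\<alpha>\<in>S. linear_factor \<alpha>) = linear_factor \<alpha> * (\<Prod>\<alpha>\<in>S - {\<alpha>}. linear_factor \<alpha>)"
      using S(1) 2 by (simp add: prod.remove)
    have "rad (linear_factor \<alpha> * ((\<Prod>\<alpha>\<in>S - {\<alpha>}. linear_factor \<alpha>) * q))"
      by (rule rad_linear_factor_square[OF fd 2(1)]) (use S(3) S' in \<open>simp add: ac_simps\<close>)
    then have "rad ((\<Prod>\<alpha>\<in>S. linear_factor \<alpha>) * q)"
      by (simp add: S' ac_simps)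
    with S show ?thesis by blast
  next
    case 3
    with S show ?thesis
      by (intro exI[of _ "insert \<alpha> S"]) (simp add: ac_simps)
  qed
qed

text \<open>A linear dependence among the \<open>Y (t_pow (int n)) v\<close> gives a nonzero
  polynomial \<open>g\<close> whose \<open>Y\<close> kills \<open>v\<close>. Applying
  \<open>X Q\<close> puts \<open>g\<close> in the ideal, and its nonzero roots provide the
  support.\<close>

lemma finite_dim_supported:
  assumes fd: "finite_dim"
  obtains S where "supported S" "1 \<in> S" "- 1 \<in> S"
proof -
  define f where "f n = Y (t_pow (int n)) v" for n
  obtain n where n: "f n \<in> span (f ` {..<n})"
    using finite_dim_dependent[OF fd] by blast
  \<comment> \<open>The condition on one coefficient is linear, holds for all smaller monomials, and
    keeps \<open>g\<close> below from being zero.\<close>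
  let ?M = "{Y (laurent_of_poly p) v | p. coeff p n = 0}"
  have "subspace ?M"
    unfolding subspace_def
  proof (intro conjI ballI allI)
    show "0 \<in> ?M"
      by (auto intro!: exI[of _ 0] simp: laurent_of_poly_simps)
  next
    fix x y assume "x \<in> ?M" "y \<in> ?M"
    then obtain p q where "x = Y (laurent_of_poly p) v" "coeff p n = 0"
      "y = Y (laurent_of_poly q) v" "coeff q n = 0" by auto
    then show "x + y \<in> ?M"
      by (auto intro!: exI[of _ "p + q"] simp: laurent_of_poly_simps op_add)
  next
    fix c x assume "x \<in> ?M"
    then obtain p where "x = Y (laurent_of_poly p) v" "coeff p n = 0" by auto
    then show "smul c x \<in> ?M"
      by (auto intro!: exI[of _ "smult c p"] simp: laurent_of_poly_simps op_const)
  qed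
  moreover have "f ` {..<n} \<subseteq> ?M"
  proof (intro image_subsetI)
    fix i assume "i \<in> {..<n}"
    then show "f i \<in> ?M"
      by (auto simp: f_def intro!: exI[of _ "monom 1 i"] simp: laurent_of_poly_simps)
  qed
  ultimately have "f n \<in> ?M"
    using n span_minimal by blast
  then obtain p where p: "f n = Y (laurent_of_poly p) v" "coeff p n = 0"
    by auto
  define g where "g = monom 1 n + smult (- 1) p"
  have "coeff g n = 1"
    by (simp add: g_def p)
  then have g0: "g \<noteq> 0" by auto
  have "Y (laurent_of_poly g) v = 0"
    using p(1) unfolding g_def by (simp only: laurent_of_poly_simps op_add op_const) (simp add: f_def)
  then have "smul (psi (Q * laurent_of_poly g)) v = 0" for Q
    using op_commute(1)[of Q "laurent_of_poly g" v] by simp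
  then have "rad (laurent_of_poly g * 1)"
    using v_nonzero by (simp add: rad_def mult.commute)
  then obtain S where S: "finite S" "0 \<notin> S" "rad ((\<Prod>\<alpha>\<in>S. linear_factor \<alpha>) * 1)"
    using rad_poly[OF fd g0] by blast
  let ?S = "S \<union> inverse ` S \<union> {1, - 1}"
  have "rad P" if "\<forall>\<alpha>\<in>?S. laurent_eval \<alpha> P = 0" for P
  proof (rule rad_dvd)
    show "(\<Prod>\<alpha>\<in>S. linear_factor \<alpha>) dvd P"
      using S that by (intro prod_linear_factor_dvd) auto
  qed (use S(3) in simp)
  then have "supported ?S"
    using S unfolding supported_def by auto
  then show thesis
    using that[of ?S] by simp
qed

text \<open>At the last nonzero power \<open>j\<close>, the coefficient in
  \<open>X_interp_power\<close> with \<open>Q = 1\<close> has to vanish.\<close>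

lemma finite_dim_weights:
  assumes fd: "finite_dim" and S: "supported S" and \<alpha>: "\<alpha> \<in> S"
  shows "\<exists>m::nat. psi (interp S \<alpha>) = step \<alpha> * of_nat m"
proof -
  obtain j where "(Y (interp S \<alpha>) ^^ j) v \<noteq> 0" "(Y (interp S \<alpha>) ^^ Suc j) v = 0"
    using finite_dim_nilpotent[OF fd] .
  then have "psi (interp S \<alpha>) - step \<alpha> * of_nat j = 0"
    using X_interp_power[OF S \<alpha>, of 1 j] by (simp del: funpow.simps of_nat_Suc)
  then show ?thesis by auto
qed

lemma finite_dim_imp_psi:
  assumes fd: "finite_dim"
  shows "\<exists>(k::nat) (l::nat) n \<alpha>. (\<forall>i\<in>{1..n::nat}. \<alpha> i \<noteq> 0 \<and> \<alpha> i \<noteq> 1 \<and> \<alpha> i \<noteq> - 1) \<and>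
    (\<forall>P. psi P = of_nat k / 2 * laurent_eval 1 P + of_nat l / 2 * laurent_eval (- 1) P
      + (\<Sum>i=1..n. laurent_eval (\<alpha> i) P))"
proof -
  obtain S where S: "supported S" "1 \<in> S" "- 1 \<in> S"
    using finite_dim_supported[OF fd] .
  obtain m :: "complex \<Rightarrow> nat" where m: "\<And>\<alpha>. \<alpha> \<in> S \<Longrightarrow> psi (interp S \<alpha>) = step \<alpha> * of_nat (m \<alpha>)"
    using finite_dim_weights[OF fd S(1)] by metis
  \<comment> \<open>The points 1 and -1, where \<open>step\<close> is 1/2, are separated; on
    \<open>T\<close> it is 1 and the multiplicities become repetitions.\<close>
  define T where "T = S - {1} - {- 1}"
  have fin: "finite S"
    by (rule supported_finite[OF S(1)])
  then obtain n and \<alpha> :: "nat \<Rightarrow> complex" where \<alpha>: "\<forall>i\<in>{1..n}. \<alpha> i \<in> T"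
    "\<forall>f :: complex \<Rightarrow> complex. (\<Sum>i=1..n. f (\<alpha> i)) = (\<Sum>\<beta>\<in>T. f \<beta> * of_nat (m \<beta>))"
    using sum_with_multiplicities[of T m] unfolding T_def by blast
  have psi: "psi P = of_nat (m 1) / 2 * laurent_eval 1 P + of_nat (m (- 1)) / 2 * laurent_eval (- 1) P
      + (\<Sum>i=1..n. laurent_eval (\<alpha> i) P)" for P
  proof -
    let ?g = "\<lambda>\<beta>. laurent_eval \<beta> P * (step \<beta> * of_nat (m \<beta>))"
    have "psi P = (\<Sum>\<beta>\<in>S. ?g \<beta>)"
      unfolding psi_eq_sum[OF S(1), of P] by (simp add: m)
    also have "\<dots> = ?g 1 + (?g (- 1) + (\<Sum>\<beta>\<in>T. ?g \<beta>))"
      unfolding T_def using fin S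
      by (subst sum.remove[of S 1], simp_all, subst sum.remove[of "S - {1}" "- 1"]) simp_all
    also have "(\<Sum>\<beta>\<in>T. ?g \<beta>) = (\<Sum>\<beta>\<in>T. laurent_eval \<beta> P * of_nat (m \<beta>))"
      by (rule sum.cong)
         (auto simp: T_def step_def inverse_eq_self_iff supported_nonzero[OF S(1)])
    also have "\<dots> = (\<Sum>i=1..n. laurent_eval (\<alpha> i) P)"
      using spec[OF \<alpha>(2), of "\<lambda>\<beta>. laurent_eval \<beta> P"] by simp
    finally show ?thesis
      by (simp add: step_def mult.commute)
  qed
  have "\<alpha> i \<noteq> 0 \<and> \<alpha> i \<noteq> 1 \<and> \<alpha> i \<noteq> - 1" if "i \<in> {1..n}" for i
    using \<alpha>(1) that supported_nonzero[OF S(1)] by (auto simp: T_def)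
  with psi show ?thesis
    by (intro exI[of _ "m 1"] exI[of _ "m (- 1)"] exI[of _ n] exI[of _ \<alpha>]) simp
qed

subsection \<open>Integrability\<close>

lemma hom_act: "A \<in> Ltw \<Longrightarrow> module_hom smul smul (act A)"
  by unfold_locales (simp_all add: act_right)

lemma hom_funpow:
  assumes "module_hom smul smul T"
  shows "module_hom smul smul (T ^^ i)"
proof (induction i)
  case 0
  then show ?case by unfold_locales simp_all
next
  case (Suc i)
  show ?case
    using module_hom_compose[OF Suc assms] by (simp add: comp_def)
qed

lemmas hom_simps = module_hom.add module_hom.scale module_hom.zero

section \<open>Locally nilpotent operators and their commutators\<close>

lemma funpow_eq_0_mono:
  assumes T: "module_hom smul smul T" and "(T ^^ r) w = 0" "r \<le> s"
  shows "(T ^^ s) w = 0"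
proof -
  have "T ^^ s = T ^^ (s - r) \<circ> T ^^ r"
    using assms(3) by (simp flip: funpow_add)
  then show ?thesis
    using assms(2) hom_simps(3)[OF hom_funpow[OF T]] by simp
qed

definition locally_nilpotent :: "('v \<Rightarrow> 'v) \<Rightarrow> bool" where
  "locally_nilpotent T \<longleftrightarrow> (\<forall>w. \<exists>r. (T ^^ r) w = 0)"

lemma subspace_nilpotent:
  assumes T: "module_hom smul smul T"
  shows "subspace {w. \<exists>r. (T ^^ r) w = 0}"
  unfolding subspace_def
proof (intro conjI ballI allI)
  fix u w assume "u \<in> {w. \<exists>r. (T ^^ r) w = 0}" "w \<in> {w. \<exists>r. (T ^^ r) w = 0}"
  then obtain r s where rs: "(T ^^ r) u = 0" "(T ^^ s) w = 0" by auto
  have "(T ^^ (r + s)) u = 0" "(T ^^ (r + s)) w = 0"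
    by (rule funpow_eq_0_mono[OF T rs(1)], simp) (rule funpow_eq_0_mono[OF T rs(2)], simp)
  then show "u + w \<in> {w. \<exists>r. (T ^^ r) w = 0}"
    using hom_simps(1)[OF hom_funpow[OF T], of "r + s"] by (auto intro!: exI[of _ "r + s"])
qed (auto simp: hom_simps[OF hom_funpow[OF T]] intro: exI[of _ 0])

lemma commute_funpow:
  assumes "\<And>w. A (B w) = B (A w)"
  shows "A ((B ^^ n) w) = (B ^^ n) (A w)"
  by (induction n) (simp_all add: assms)

lemma commutator_funpow:
  assumes B: "module_hom smul smul B" and AB: "\<And>w. A (B w) = B (A w) + C w" and CB: "\<And>w. C (B w) = B (C w)"
  shows "A ((B ^^ Suc n) w) = (B ^^ Suc n) (A w) + smul (of_nat (Suc n)) ((B ^^ n) (C w))"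
proof (induction n)
  case (Suc n)
  have "A ((B ^^ Suc (Suc n)) w) = B (A ((B ^^ Suc n) w)) + C ((B ^^ Suc n) w)"
    by (simp add: AB)
  also have "C ((B ^^ Suc n) w) = (B ^^ Suc n) (C w)"
    by (rule commute_funpow[of C B, OF CB])
  finally show ?case
    unfolding Suc.IH
    by (simp add: hom_simps[OF B] of_nat_Suc[of "Suc n"] scale_left_distrib add_ac del: of_nat_Suc)
qed (simp add: AB)

text \<open>A Heisenberg argument: some power of \<open>B\<close> kills all \<open>A\<close>-powers
  of \<open>w\<close>, and applying \<open>A\<close> repeatedly trades each \<open>B\<close> for a
  \<open>C\<close>.\<close>

lemma locally_nilpotent_commutator:
  assumes hom: "module_hom smul smul A" "module_hom smul smul B" "module_hom smul smul C"
    and AB: "\<And>w. A (B w) = B (A w) + C w"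
    and CA: "\<And>w. C (A w) = A (C w)" and CB: "\<And>w. C (B w) = B (C w)"
    and nil: "locally_nilpotent A" "locally_nilpotent B"
  shows "locally_nilpotent C"
  unfolding locally_nilpotent_def
proof
  fix w
  obtain c where c: "(A ^^ c) w = 0"
    using nil(1) by (auto simp: locally_nilpotent_def)
  have "\<forall>j. \<exists>r. (B ^^ r) ((A ^^ j) w) = 0"
    using nil(2) by (simp add: locally_nilpotent_def)
  from choice[OF this] obtain r where r: "\<And>j. (B ^^ r j) ((A ^^ j) w) = 0"
    by blast
  \<comment> \<open>Only the indices below \<open>c\<close> count, so a finite sum bounds all the
    exponents needed.\<close>
  define N where "N = (\<Sum>j<c. r j)"
  have BA: "(B ^^ N) ((A ^^ j) w) = 0" for j
  proof (cases "j < c")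
    case True
    then have "r j \<le> N"
      unfolding N_def by (intro member_le_sum) auto
    then show ?thesis
      by (rule funpow_eq_0_mono[OF hom(2) r])
  next
    case False
    then have "(A ^^ j) w = 0"
      by (intro funpow_eq_0_mono[OF hom(1) c]) simp
    then show ?thesis
      by (simp add: hom_simps[OF hom_funpow[OF hom(2)]])
  qed
  have "\<forall>j. (C ^^ k) ((B ^^ (N - k)) ((A ^^ j) w)) = 0" if "k \<le> N" for k
    using that
  proof (induction k)
    case 0
    then show ?case using BA by simp
  next
    case (Suc k)
    show ?case
    proof
      fix j
      let ?u = "(A ^^ j) w" and ?n = "N - Suc k"
      have n: "N - k = Suc ?n"
        using Suc.prems by simp
      have IH: "(C ^^ k) ((B ^^ Suc ?n) ((A ^^ j) w)) = 0" for j
        using Suc by (simp only: n)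
      \<comment> \<open>Commuting \<open>A\<close> to the right yields a term killed by the
        induction hypothesis at \<open>Suc j\<close> and a nonzero multiple of the desired
        vector.\<close>
      have "0 = A ((C ^^ k) ((B ^^ Suc ?n) ?u))"
        unfolding IH by (simp add: hom_simps[OF hom(1)])
      also have "\<dots> = (C ^^ k) (A ((B ^^ Suc ?n) ?u))"
        by (rule commute_funpow) (simp add: CA)
      also have "\<dots> = (C ^^ k) ((B ^^ Suc ?n) ((A ^^ Suc j) w))
          + smul (of_nat (Suc ?n)) ((C ^^ k) ((B ^^ ?n) (C ?u)))"
        unfolding commutator_funpow[where A = A and B = B and C = C, OF hom(2) AB CB]
        by (simp add: hom_simps[OF hom_funpow[OF hom(3)]] del: of_nat_Suc)
      finally have "(C ^^ k) ((B ^^ ?n) (C ?u)) = 0"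
        unfolding IH by (simp del: of_nat_Suc)
      moreover have "(B ^^ ?n) (C ?u) = C ((B ^^ ?n) ?u)"
        by (rule commute_funpow[of C B, OF CB, symmetric])
      ultimately show "(C ^^ Suc k) ((B ^^ ?n) ?u) = 0"
        by (simp add: funpow_swap1)
    qed
  qed
  from this[of N, rule_format, of 0] show "\<exists>r. (C ^^ r) w = 0"
    by auto
qed

text \<open>Adjoins one operator \<open>T\<close> to a family that already has a finite-dimensional
  stable space. Local nilpotency keeps the span of all \<open>T\<close>-powers finite-dimensional,
  and the commutators with \<open>T\<close> stay in the family.\<close>

lemma finite_closure:
  assumes T: "module_hom smul smul T" "locally_nilpotent T" and B: "finite B"
    and U: "\<And>U. U \<in> \<U> \<Longrightarrow> module_hom smul smul U"
    and stable: "\<And>U w. U \<in> \<U> \<Longrightarrow> w \<in> span B \<Longrightarrow> U w \<in> span B"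
    and comm: "\<And>U. U \<in> \<U> \<Longrightarrow> \<exists>Q\<in>\<U>. (\<forall>w. U (T w) = T (U w) + Q w) \<and> (\<forall>w. Q (T w) = T (Q w))"
  obtains B' where "finite B'" "span B \<subseteq> span B'" "\<And>w. w \<in> span B' \<Longrightarrow> T w \<in> span B'"
    "\<And>U w. U \<in> \<U> \<Longrightarrow> w \<in> span B' \<Longrightarrow> U w \<in> span B'"
proof -
  define B' where "B' = (\<Union>b\<in>B. range (\<lambda>i. (T ^^ i) b))"
  have stable_if: "F w \<in> span B'" if F: "module_hom smul smul F" and sub: "\<And>b. b \<in> C \<Longrightarrow> F b \<in> span B'" and w: "w \<in> span C" for F w C
  proof -
    have "subspace {w. F w \<in> span B'}"
      by (auto simp: subspace_def hom_simps[OF F] span_zero span_add span_scale)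
    then have "span C \<subseteq> {w. F w \<in> span B'}"
      using sub by (intro span_minimal) auto
    then show ?thesis
      using w by auto
  qed
  have Tpow: "(T ^^ i) w \<in> span B'" if "w \<in> span B" for i w
    by (rule stable_if[OF hom_funpow[OF T(1)] _ that]) (auto simp: B'_def intro: span_base)
  show thesis
  proof (rule that[of B'])
    have "\<forall>b. \<exists>r. (T ^^ r) b = 0"
      using T(2) by (simp add: locally_nilpotent_def)
    from choice[OF this] obtain r where r: "\<And>b. (T ^^ r b) b = 0"
      by blast
    have "B' \<subseteq> insert 0 (\<Union>b\<in>B. (\<lambda>i. (T ^^ i) b) ` {..<r b})"
    proof
      fix x assume "x \<in> B'"
      then obtain b i where b: "b \<in> B" "x = (T ^^ i) b"
        by (auto simp: B'_def)
      then show "x \<in> insert 0 (\<Union>b\<in>B. (\<lambda>i. (T ^^ i) b) ` {..<r b})"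
        using funpow_eq_0_mono[OF T(1) r, of b i] by (cases "i < r b") auto
    qed
    then show "finite B'"
      by (rule finite_subset) (use B in auto)
    show "span B \<subseteq> span B'"
      using Tpow[of _ 0] by auto
    show "T w \<in> span B'" if "w \<in> span B'" for w
    proof (rule stable_if[OF T(1) _ that])
      fix x assume "x \<in> B'"
      then obtain b i where b: "b \<in> B" "x = (T ^^ i) b"
        by (auto simp: B'_def)
      then show "T x \<in> span B'"
        using Tpow[OF span_base[OF b(1)], of "Suc i"] by simp
    qed
    show "U w \<in> span B'" if U': "U \<in> \<U>" and "w \<in> span B'" for U w
    proof (rule stable_if[OF U[OF U'] _ that(2)])
      fix x assume "x \<in> B'"
      then obtain b i where b: "b \<in> B" "x = (T ^^ i) b"
        by (auto simp: B'_def)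
      obtain Q where Q: "Q \<in> \<U>" "\<And>w. U (T w) = T (U w) + Q w" "\<And>w. Q (T w) = T (Q w)"
        using comm[OF U'] by blast
      have mem: "U b \<in> span B" "Q b \<in> span B"
        using stable U' Q(1) span_base[OF b(1)] by auto
      show "U x \<in> span B'"
      proof (cases i)
        case 0
        then show ?thesis using Tpow[OF mem(1), of 0] b by simp
      next
        case (Suc n)
        show ?thesis
          unfolding b Suc commutator_funpow[where B = T and A = U and C = Q, OF T(1) Q(2,3)]
          by (intro span_add span_scale Tpow mem)
      qed
    qed
  qed
qed

text \<open>Moving \<open>Z\<close> past one factor gives \<open>X ?Q\<close>, and \<open>?Q\<close>
  vanishes at \<open>\<alpha>\<close>: either \<open>\<alpha>\<close> is its own inverse and the
  difference vanishes, or the flipped interpolant does.\<close>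

lemma Z_interp_power:
  assumes S: "supported S" and \<alpha>: "\<alpha> \<in> S"
  shows "Z C ((Y (interp S \<alpha>) ^^ r) v) = 0"
proof (induction r)
  case (Suc r)
  let ?Q = "(C - laurent_flip C) * laurent_flip (interp S \<alpha>)"
  have "laurent_eval \<alpha> ?Q = 0"
    using supported_nonzero[OF S \<alpha>] eval_interp_supported[OF S supported_inverse[OF S \<alpha>], of \<alpha>]
    by auto
  then have "X ?Q ((Y (interp S \<alpha>) ^^ r) v) = 0"
    by (cases r) (simp, simp add: X_interp_power[OF S \<alpha>] del: funpow.simps)
  then show ?case
    using Suc by (simp add: op_commute)
qed simp

text \<open>The value of \<open>psi\<close> makes the coefficient of \<open>X_interp_power\<close>
  at \<open>j = m\<close> zero, so this power is a singular vector.\<close>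

lemma Y_interp_power_eq_0:
  assumes S: "supported S" and \<alpha>: "\<alpha> \<in> S" and m: "psi (interp S \<alpha>) = step \<alpha> * of_nat m"
  shows "(Y (interp S \<alpha>) ^^ Suc m) v = 0"
proof (rule singular_eq_0[of "{(Y (interp S \<alpha>) ^^ Suc m) v}"])
  fix s Q assume s: "s \<in> {(Y (interp S \<alpha>) ^^ Suc m) v}"
  show "X Q s = 0"
    using s X_interp_power[OF S \<alpha>, of Q m] m by (simp del: funpow.simps)
  show "Z Q s = 0"
    using s Z_interp_power[OF S \<alpha>, of Q "Suc m"] by simp
  obtain c where "H Q s = smul c s"
    using s H_interp_power[OF S \<alpha>, of Q "Suc m"] by blast
  then show "H Q s \<in> span {(Y (interp S \<alpha>) ^^ Suc m) v}"
    using s by (auto intro: span_scale span_base)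
  show "\<exists>r. s \<in> weight_space (Suc r)"
    using s weight_space_Y_power[where P = "interp S \<alpha>" and r = "Suc m"] by blast
qed simp

text \<open>The vectors killed by some power form a lower stable subspace: \<open>Y Q\<close> costs
  one extra power, because its commutator with \<open>Y P\<close> is central.\<close>

lemma locally_nilpotent_Y:
  assumes "(Y P ^^ r) v = 0"
  shows "locally_nilpotent (Y P)"
proof -
  let ?M = "{w. \<exists>r. (Y P ^^ r) w = 0}"
  have hom: "module_hom smul smul (Y P)"
    by (simp add: hom_act)
  have "lower_stable ?M"
    unfolding lower_stable_def
  proof (intro conjI ballI allI subspace_nilpotent hom)
    fix w Q assume "w \<in> ?M"
    then obtain r where r: "(Y P ^^ r) w = 0" by auto
    have rs: "(Y P ^^ Suc r) w = 0"
      by (rule funpow_eq_0_mono[OF hom r]) simp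
    have "Y Q ((Y P ^^ Suc r) w) = (Y P ^^ Suc r) (Y Q w)
        + smul (of_nat (Suc r)) ((Y P ^^ r) (W (laurent_flip Q * P) w))"
      by (rule commutator_funpow[where A = "Y Q" and B = "Y P" and C = "W (laurent_flip Q * P)",
          OF hom op_commute(2) op_commute(3)])
    moreover have "(Y P ^^ r) (W (laurent_flip Q * P) w) = W (laurent_flip Q * P) ((Y P ^^ r) w)"
      by (rule commute_funpow[where A = "W (laurent_flip Q * P)" and B = "Y P", OF op_commute(3), symmetric])
    ultimately have "(Y P ^^ Suc r) (Y Q w) = 0"
      using r rs by (simp del: funpow.simps)
    then show "Y Q w \<in> ?M" by blast
    have "(Y P ^^ r) (W Q w) = W Q ((Y P ^^ r) w)"
      by (rule commute_funpow[where A = "W Q" and B = "Y P", OF op_commute(3), symmetric])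
    then show "W Q w \<in> ?M" using r by auto
  qed
  then have "?M = UNIV"
    using assms by (intro lower_stable_eq_UNIV) auto
  then show ?thesis
    by (auto simp: locally_nilpotent_def)
qed

text \<open>Extends the vanishing from \<open>v\<close> to the module. All vanishing
  \<open>P\<close> are treated together, since passing \<open>Y Q\<close> turns \<open>Y P\<close>
  into a \<open>W\<close> of another vanishing function.\<close>

lemma supported_annihilates:
  assumes S: "supported S" and P: "\<And>\<beta>. \<beta> \<in> S \<Longrightarrow> laurent_eval \<beta> P = 0"
  shows "Y P w = 0" "W P w = 0"
proof -
  let ?van = "\<lambda>P. \<forall>\<beta>\<in>S. laurent_eval \<beta> P = 0"
  let ?M = "{w. \<forall>P. ?van P \<longrightarrow> Y P w = 0 \<and> W P w = 0}"
  have "lower_stable ?M"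
    unfolding lower_stable_def
  proof (intro conjI ballI allI)
    show "subspace ?M"
      by (auto simp: subspace_def act_right)
    fix w Q assume w: "w \<in> ?M"
    have "?van (laurent_flip P * Q)" if "?van P" for P
      using that supported_nonzero[OF S] supported_inverse[OF S] by simp
    then show "Y Q w \<in> ?M"
      using w by (auto simp: op_commute(2)[of _ Q] op_commute(3))
    have "Y P (W Q w) = W Q (Y P w)" "W P (W Q w) = W Q (W P w)" for P
      by (rule op_commute(3)[symmetric]) (rule op_commute(4))
    then show "W Q w \<in> ?M"
      using w by simp
  qed
  moreover have "v \<in> ?M"
  proof (intro CollectI allI impI conjI)
    fix P assume P: "?van P"
    then show "Y P v = 0"
      by (intro rad_supported_Y_W[OF S]) auto
    show "W P v = 0"
      using P supported_inverse[OF S] rad_supported_Y_W(2)[OF S, of "laurent_flip P" 1] by simp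
  qed
  ultimately have "?M = UNIV"
    by (rule lower_stable_eq_UNIV)
  then show "Y P w = 0" "W P w = 0"
    using P by blast+
qed

lemma supported_expand:
  assumes S: "supported S"
  shows "Y P w = (\<Sum>\<alpha>\<in>S. smul (laurent_eval \<alpha> P) (Y (interp S \<alpha>) w))"
    "W P w = (\<Sum>\<alpha>\<in>S. smul (laurent_eval \<alpha> P) (W (interp S \<alpha>) w))"
proof -
  let ?P = "\<Sum>\<alpha>\<in>S. laurent_const (laurent_eval \<alpha> P) * interp S \<alpha>"
  have "Y (P - ?P) w = 0" "W (P - ?P) w = 0"
    by (rule supported_annihilates[OF S], simp add: eval_interp_sum[OF S])+
  then show "Y P w = (\<Sum>\<alpha>\<in>S. smul (laurent_eval \<alpha> P) (Y (interp S \<alpha>) w))"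
    "W P w = (\<Sum>\<alpha>\<in>S. smul (laurent_eval \<alpha> P) (W (interp S \<alpha>) w))"
    by (simp_all add: op_diff op_sum op_const)
qed

text \<open>A finite-dimensional space around \<open>v\<close> is closed first under the commuting
  \<open>W\<close> operators, then under the \<open>Y\<close> operators, whose commutators are by
  then available.\<close>

lemma finite_dim_if_weights:
  assumes S: "supported S" and m: "\<And>\<alpha>. \<alpha> \<in> S \<Longrightarrow> \<exists>m::nat. psi (interp S \<alpha>) = step \<alpha> * of_nat m"
  shows "finite_dim"
proof -
  have nil_Y: "locally_nilpotent (Y (interp S \<alpha>))" if \<alpha>: "\<alpha> \<in> S" for \<alpha>
    using m[OF \<alpha>] Y_interp_power_eq_0[OF S \<alpha>] locally_nilpotent_Y by metis
  have nil_W: "locally_nilpotent (W (interp S \<alpha>))" if \<alpha>: "\<alpha> \<in> S" for \<alpha>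
  proof -
    let ?\<beta> = "inverse \<alpha>"
    \<comment> \<open>On \<open>S\<close> the flipped interpolant at the inverse agrees with the one
      at \<open>\<alpha>\<close>; thus \<open>W (interp S \<alpha>)\<close> is a commutator of two
      locally nilpotent \<open>Y\<close> operators.\<close>
    let ?R = "laurent_flip (interp S ?\<beta>) * interp S \<alpha>"
    have "laurent_eval \<gamma> (interp S \<alpha> - ?R) = 0" if "\<gamma> \<in> S" for \<gamma>
      using eval_interp_supported[OF S that, of \<alpha>] supported_nonzero[OF S that]
        eval_interp_supported[OF S supported_inverse[OF S that], of ?\<beta>] by simp
    then have "W (interp S \<alpha> - ?R) w = 0" for w
      by (rule supported_annihilates[OF S])
    then have R: "W (interp S \<alpha>) = W ?R"
      by (intro ext) (simp add: op_diff)
    show ?thesis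
      unfolding R
      by (rule locally_nilpotent_commutator[of "Y (interp S ?\<beta>)" "Y (interp S \<alpha>)"])
        (simp_all add: hom_act op_commute(3) nil_Y \<alpha> supported_inverse[OF S], rule op_commute(2))
  qed
  have fin: "finite S"
    by (rule supported_finite[OF S])
  have "\<exists>B. finite B \<and> v \<in> span B \<and> (\<forall>\<beta>\<in>T. \<forall>w\<in>span B. W (interp S \<beta>) w \<in> span B)" if "T \<subseteq> S" for T
    using finite_subset[OF that fin] that
  proof (induction T rule: finite_induct)
    case empty
    then show ?case
      by (intro exI[of _ "{v}"]) (simp add: span_base)
  next
    case (insert \<alpha> T)
    then obtain B where B: "finite B" "v \<in> span B" "\<And>\<beta> w. \<beta> \<in> T \<Longrightarrow> w \<in> span B \<Longrightarrow> W (interp S \<beta>) w \<in> span B"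
      by auto
    \<comment> \<open>\<open>W 0\<close> is the zero operator and serves as the commutator required
      by \<open>finite_closure\<close>.\<close>
    let ?U = "insert (W 0) ((\<lambda>\<beta>. W (interp S \<beta>)) ` T)"
    obtain B' where B': "finite B'" "span B \<subseteq> span B'" "\<And>w. w \<in> span B' \<Longrightarrow> W (interp S \<alpha>) w \<in> span B'"
      "\<And>U w. U \<in> ?U \<Longrightarrow> w \<in> span B' \<Longrightarrow> U w \<in> span B'"
      by (rule finite_closure[of "W (interp S \<alpha>)" B ?U])
        (use insert.prems B in \<open>auto simp: hom_act nil_W op_commute(4) span_zero\<close>)
    then show ?case
      using B(2) by (intro exI[of _ B']) auto
  qed
  from this[of S] obtain B0 where B0: "finite B0" "v \<in> span B0"
    "\<And>\<beta> w. \<beta> \<in> S \<Longrightarrow> w \<in> span B0 \<Longrightarrow> W (interp S \<beta>) w \<in> span B0"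
    by auto
  have B0_W: "W P w \<in> span B0" if "w \<in> span B0" for P w
    unfolding supported_expand(2)[OF S, of P w] by (intro span_sum span_scale B0 that)
  have "\<exists>B. finite B \<and> v \<in> span B \<and> (\<forall>P. \<forall>w\<in>span B. W P w \<in> span B)
      \<and> (\<forall>\<beta>\<in>T. \<forall>w\<in>span B. Y (interp S \<beta>) w \<in> span B)" if "T \<subseteq> S" for T
    using finite_subset[OF that fin] that
  proof (induction T rule: finite_induct)
    case empty
    then show ?case
      using B0 B0_W by (intro exI[of _ B0]) simp
  next
    case (insert \<alpha> T)
    then obtain B where B: "finite B" "v \<in> span B" "\<And>P w. w \<in> span B \<Longrightarrow> W P w \<in> span B"
      "\<And>\<beta> w. \<beta> \<in> T \<Longrightarrow> w \<in> span B \<Longrightarrow> Y (interp S \<beta>) w \<in> span B"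
      by auto
    let ?U = "range (\<lambda>P. W P) \<union> (\<lambda>\<beta>. Y (interp S \<beta>)) ` T"
    have comm: "\<exists>Q\<in>?U. (\<forall>w. U (Y (interp S \<alpha>) w) = Y (interp S \<alpha>) (U w) + Q w)
        \<and> (\<forall>w. Q (Y (interp S \<alpha>) w) = Y (interp S \<alpha>) (Q w))" if "U \<in> ?U" for U
      using that
    proof
      assume "U \<in> range (\<lambda>P. W P)"
      then show ?thesis
        by (intro bexI[of _ "W 0"]) (auto simp: op_commute(3))
    next
      assume "U \<in> (\<lambda>\<beta>. Y (interp S \<beta>)) ` T"
      then obtain \<beta> where "U = Y (interp S \<beta>)" by auto
      then show ?thesis
        by (intro bexI[of _ "W (laurent_flip (interp S \<beta>) * interp S \<alpha>)"]) (auto simp: op_commute(2)[of "interp S \<beta>" "interp S \<alpha>"] op_commute(3))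
    qed
    obtain B' where B': "finite B'" "span B \<subseteq> span B'" "\<And>w. w \<in> span B' \<Longrightarrow> Y (interp S \<alpha>) w \<in> span B'"
      "\<And>U w. U \<in> ?U \<Longrightarrow> w \<in> span B' \<Longrightarrow> U w \<in> span B'"
      by (rule finite_closure[of "Y (interp S \<alpha>)" B ?U, OF _ _ _ _ _ comm])
        (use insert.prems B in \<open>auto simp: hom_act nil_Y\<close>)
    then show ?case
      using B(2) by (intro exI[of _ B']) auto
  qed
  from this[of S] obtain B where B: "finite B" "v \<in> span B" "\<And>P w. w \<in> span B \<Longrightarrow> W P w \<in> span B"
    "\<And>\<beta> w. \<beta> \<in> S \<Longrightarrow> w \<in> span B \<Longrightarrow> Y (interp S \<beta>) w \<in> span B"
    by auto
  have "Y P w \<in> span B" if "w \<in> span B" for P w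
    unfolding supported_expand(1)[OF S, of P w] by (intro span_sum span_scale B that)
  then have "lower_stable (span B)"
    using B by (simp add: lower_stable_def)
  then have "span B = UNIV"
    using B(2) by (rule lower_stable_eq_UNIV)
  then show ?thesis
    using B(1) by (auto simp: finite_dim_def)
qed

lemma psi_imp_finite_dim:
  fixes k l n :: nat and \<alpha> :: "nat \<Rightarrow> complex"
  assumes \<alpha>: "\<And>i. i \<in> {1..n} \<Longrightarrow> \<alpha> i \<noteq> 0 \<and> \<alpha> i \<noteq> 1 \<and> \<alpha> i \<noteq> - 1"
    and psi: "\<And>P. psi P = of_nat k / 2 * laurent_eval 1 P + of_nat l / 2 * laurent_eval (- 1) P
      + (\<Sum>i=1..n. laurent_eval (\<alpha> i) P)"
  shows "finite_dim"
proof -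
  \<comment> \<open>The points 1 and -1 are present even when \<open>k\<close> or \<open>l\<close>
    is zero, and inverses are added for closure; such points may get multiplicity 0.\<close>
  define S where "S = {1, - 1} \<union> \<alpha> ` {1..n} \<union> inverse ` \<alpha> ` {1..n}"
  have S0: "0 \<notin> S"
    using \<alpha> by (force simp: S_def)
  have S: "supported S"
    unfolding supported_def
  proof (intro conjI allI impI S0)
    fix P assume "\<forall>\<alpha>\<in>S. laurent_eval \<alpha> P = 0"
    then show "rad P"
      using \<alpha> by (simp add: rad_def psi S_def)
  qed (auto simp: S_def)
  have "\<exists>m::nat. psi (interp S \<beta>) = step \<beta> * of_nat m" if \<beta>: "\<beta> \<in> S" for \<beta>
  proof -
    have "(\<Sum>i=1..n. laurent_eval (\<alpha> i) (interp S \<beta>)) = (\<Sum>i=1..n. of_nat (of_bool (\<alpha> i = \<beta>)))"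
      by (intro sum.cong refl) (subst eval_interp_supported[OF S], auto simp: S_def)
    also have "\<dots> = of_nat (\<Sum>i=1..n. of_bool (\<alpha> i = \<beta>))"
      by (rule of_nat_sum[symmetric])
    finally have p: "psi (interp S \<beta>) = of_nat k / 2 * of_bool (\<beta> = 1) + of_nat l / 2 * of_bool (\<beta> = - 1)
        + of_nat (\<Sum>i=1..n. of_bool (\<alpha> i = \<beta>))"
      unfolding psi by (subst (1 2) eval_interp_supported[OF S]) (auto simp: S_def)
    \<comment> \<open>At 1 and -1 only \<open>k\<close> and \<open>l\<close> contribute, matching
      the half-integral \<open>step\<close> there.\<close>
    have z: "(\<Sum>i=1..n. of_bool (\<alpha> i = \<beta>)) = (0::nat)" if "\<beta> = 1 \<or> \<beta> = - 1"
      by (rule sum.neutral) (use \<alpha> that in auto)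
    consider "\<beta> = 1" | "\<beta> = - 1" | "\<beta> \<noteq> 1" "\<beta> \<noteq> - 1" by blast
    then show ?thesis
    proof cases
      case 1
      then show ?thesis
        using p z by (intro exI[of _ k]) (simp add: step_def)
    next
      case 2
      then show ?thesis
        using p z by (intro exI[of _ l]) (simp add: step_def)
    next
      case 3
      then show ?thesis
        using p supported_nonzero[OF S \<beta>]
        by (intro exI[of _ "\<Sum>i=1..n. of_bool (\<alpha> i = \<beta>)"]) (simp add: step_def inverse_eq_self_iff)
    qed
  qed
  then show ?thesis
    by (rule finite_dim_if_weights[OF S])
qed

end

theorem theorem5p4p5:
  fixes smul :: "complex \<Rightarrow> 'v::ab_group_add \<Rightarrow> 'v"
    and act :: "loop \<Rightarrow> 'v \<Rightarrow> 'v"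
    and \<phi> :: "loop \<Rightarrow> complex"
    and v\<^sub>\<phi> :: 'v
  assumes "\<phi> \<in> Ltw_zero_dual"
    and "is_simple_highest_weight_module smul act \<phi> v\<^sub>\<phi>"
  shows "Ltw_module.finite_dim smul \<longleftrightarrow>
    (\<exists>\<nu>\<^sub>1 \<in> {of_nat k / 2 | k. True}. \<exists>\<nu>\<^sub>m\<^sub>1 \<in> {of_nat k / 2 | k. True}.
     \<exists>(n::nat) (\<alpha> :: nat \<Rightarrow> complex).
       (\<forall>i\<in>{1..n}. \<alpha> i \<noteq> 0 \<and> \<alpha> i \<noteq> 1 \<and> \<alpha> i \<noteq> - 1) \<and>
       (\<forall>a. \<phi> (w_plus a 0) =
          \<nu>\<^sub>1 * 2 ^ a + \<nu>\<^sub>m\<^sub>1 * (- 2) ^ a + (\<Sum>i=1..n. (\<alpha> i + inverse (\<alpha> i)) ^ a)) \<and>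
       (\<forall>a. \<phi> (w_minus a 1) =
          (\<Sum>i=1..n. (\<alpha> i + inverse (\<alpha> i)) ^ a * (\<alpha> i - inverse (\<alpha> i)))))"
    (is "?fd \<longleftrightarrow> ?R")
proof -
  interpret Ltw_module smul act
    using assms(2) by (simp add: is_simple_highest_weight_module_def)
  interpret simple_hw_module smul act \<phi> v\<^sub>\<phi>
    by unfold_locales (use assms in \<open>simp_all add: is_simple_highest_weight_module_def\<close>)
  have w: "\<phi> (w_plus a 0) = psi (t_plus ^ a)" "\<phi> (w_minus a 1) = psi (t_plus ^ a * t_minus)" for a
    by (simp_all only: psi_def w_plus_minus_eq_loop_h)
  show ?thesis
  proof
    assume fd: ?fd
    obtain k l n :: nat and \<alpha> :: "nat \<Rightarrow> complex" where \<alpha>: "\<forall>i\<in>{1..n}. \<alpha> i \<noteq> 0 \<and> \<alpha> i \<noteq> 1 \<and> \<alpha> i \<noteq> - 1"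
      and psi: "\<forall>P. psi P = of_nat k / 2 * laurent_eval 1 P + of_nat l / 2 * laurent_eval (- 1) P
        + (\<Sum>i=1..n. laurent_eval (\<alpha> i) P)"
      using finite_dim_imp_psi[OF fd] by blast
    \<comment> \<open>At 1 and -1, \<open>t_plus\<close> takes the values 2 and -2 while
      \<open>t_minus\<close> vanishes, so \<open>k\<close> and \<open>l\<close> drop out of the
      second formula.\<close>
    show ?R
      by (rule bexI[of _ "of_nat k / 2"], rule bexI[of _ "of_nat l / 2"],
          intro exI[of _ n] exI[of _ \<alpha>] conjI allI ballI)
        (unfold w psi[rule_format], use \<alpha> in \<open>auto simp: laurent_eval_t_plus_minus intro!: sum.cong\<close>)
  next
    assume ?R
    then obtain k l n :: nat and \<alpha> :: "nat \<Rightarrow> complex" where \<alpha>: "\<forall>i\<in>{1..n}. \<alpha> i \<noteq> 0 \<and> \<alpha> i \<noteq> 1 \<and> \<alpha> i \<noteq> - 1"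
      and plus: "\<forall>a. \<phi> (w_plus a 0) = of_nat k / 2 * 2 ^ a + of_nat l / 2 * (- 2) ^ a
        + (\<Sum>i=1..n. (\<alpha> i + inverse (\<alpha> i)) ^ a)"
      and minus: "\<forall>a. \<phi> (w_minus a 1) = (\<Sum>i=1..n. (\<alpha> i + inverse (\<alpha> i)) ^ a * (\<alpha> i - inverse (\<alpha> i)))"
      by blast
    let ?g = "\<lambda>P. of_nat k / 2 * laurent_eval 1 P + of_nat l / 2 * laurent_eval (- 1) P
        + (\<Sum>i=1..n. laurent_eval (\<alpha> i) P)"
    \<comment> \<open>The given formulas are extended by linearity from the spanning family to all
      Laurent polynomials.\<close>
    have "psi P = ?g P" for P
    proof (rule laurent_functional_eqI)
      show "?g (laurent_const c * P) = c * ?g P" for c P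
      proof -
        have "(\<Sum>i=1..n. laurent_eval (\<alpha> i) (laurent_const c * P)) = c * (\<Sum>i=1..n. laurent_eval (\<alpha> i) P)"
          using \<alpha> by (simp add: sum_distrib_left)
        then show ?thesis
          by (simp add: algebra_simps)
      qed
      show "psi (t_plus ^ a) = ?g (t_plus ^ a)" for a
        using plus[rule_format, of a] \<alpha> unfolding w by (simp add: laurent_eval_t_plus_minus)
      show "psi (t_plus ^ a * t_minus) = ?g (t_plus ^ a * t_minus)" for a
        using minus[rule_format, of a] \<alpha> unfolding w by (simp add: laurent_eval_t_plus_minus)
    qed (simp_all add: sum.distrib distrib_left)
    then show ?fd
      using \<alpha> psi_imp_finite_dim by blast
  qed
qed

end
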